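(* Let $\theta=1$ (bosons) and let $\beta>0$ be given. There exists a constant $R_0$ such that if $|||F_0|||$ and $\beta^{-2}(R_0+R_0^2)$ are sufficiently small with $F_0\ge 0$, then the quantum Boltzmann equation $$\partial_tF+v\cdot\nabla_xF=Q[F,F;F],\qquad F(0,x,v)=F_0(x,v),\qquad (t,x,v)\in\mathbb{R}_+\times\mathbb{R}^3\times\mathbb{R}^3,$$ has a unique mild solution $F\in S_{R_0}$ with $F\ge 0$.
   Context: Collision operator (dependence on $t,x$ suppressed): $$Q[F,F;F](v)=\int_{\mathbb{R}^3}\int_{\mathbb{S}^2}|\omega\cdot(v-u)|\Big[F(u')F(v')(1+\theta F(u)+\theta F(v))-F(u)F(v)(1+\theta F(u')+\theta F(v'))\Big]d\omega\,du,$$ where $u'=u+\omega(\omega\cdot(v-u))$, $v'=v-\omega(\omega\cdot(v-u))$. Function space: $$S=\Big\{F\in C^0(\mathbb{R}_+\times\mathbb{R}^3\times\mathbb{R}^3):\ |F(t,x,v)|\le c\,e^{-\beta(|x|^2+|v|^2)}\text{ for some }c>0\Big\},\qquad |||F|||=\sup_{t,x,v}\Big(e^{\beta(|x|^2+|v|^2)}|F(t,x,v)|\Big),$$ and $S_R=\{F\in S:\ |||F|||\le R\}$. For the time-independent initial datum $F_0(x,v)$ the same norm reads $|||F_0|||=\sup_{x,v}e^{\beta(|x|^2+|v|^2)}|F_0(x,v)|$. For a function $F(t,x,v)$ put $F^{\#}(t,x,v)=F(t,x+tv,v)$ and $Q^{\#}[F,F;F](t,x,v)=Q[F,F;F](t,x+tv,v)$;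 the equation is equivalently $\partial_tF^{\#}=Q^{\#}[F,F;F]$. A mild solution is a function $F\in S$ satisfying $$F^{\#}(t,x,v)=F_0(x,v)+\int_0^tQ^{\#}[F,F;F](\tau,x,v)\,d\tau .$$
   Formalization: Membership in S and S_{R_0} is imposed on F^# instead of F: for nonzero F_0 ≥ 0, conservation of mass, momentum and energy makes the second spatial moment of F grow like t², so no mild solution F lies in S itself; F_0 is taken continuous. *)

theory Defs
  imports "HOL-Analysis.Analysis"
begin

type_synonym vec3 = "real ^ 3"

text \<open>
  A phase-space density \<open>F t x v\<close> is a total function on \<open>real\<close>, but only its values at
  times \<open>t \<ge> 0\<close> are meaningful; every notion below looks at \<open>t \<ge> 0\<close> only.
\<close>

type_synonym density = "real \<Rightarrow> vec3 \<Rightarrow> vec3 \<Rightarrow> real"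


text \<open>
  Surface measure on the unit sphere, obtained from Lebesgue measure by integration in polar
  coordinates: \<open>\<sigma>(A)\<close> is \<open>3\<close> times the volume of the cone \<open>{r \<omega> | 0 < r < 1, \<omega> \<in> A}\<close>.
  The total mass is \<open>4 pi\<close>, see \<open>emeasure_sphere_measure\<close>.
\<close>

definition sphere_measure :: "vec3 measure" where
  "sphere_measure =
     scale_measure 3
       (distr (restrict_space lborel (ball 0 1 - {0}))
              (restrict_space borel (sphere 0 1))
              (\<lambda>x. x /\<^sub>R norm x))"

lemma space_sphere_measure: "space sphere_measure = sphere 0 1"
  by (simp add: sphere_measure_def space_scale_measure space_restrict_space)

lemma emeasure_sphere_measure: "emeasure sphere_measure (sphere 0 1) = ennreal (4 * pi)"
proof -
  let ?M = "restrict_space lborel (ball 0 1 - {0}) :: vec3 measure"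
  let ?N = "restrict_space borel (sphere 0 1) :: vec3 measure"
  have sp: "space ?M = ball 0 1 - {0}"
    by (simp add: space_restrict_space)
  have "(\<lambda>x::vec3. x /\<^sub>R norm x) \<in> borel_measurable borel"
    by measurable
  then have "(\<lambda>x. x /\<^sub>R norm x) \<in> borel_measurable ?M"
    by (intro measurable_restrict_space1) simp
  then have m: "(\<lambda>x. x /\<^sub>R norm x) \<in> measurable ?M ?N"
    by (intro measurable_restrict_space2) (auto simp: sp)
  have "(\<lambda>x. x /\<^sub>R norm x) -` sphere 0 1 \<inter> space ?M = (ball 0 1 - {0} :: vec3 set)"
    by (auto simp: sp)
  moreover have "sphere 0 1 \<in> sets ?N"
    using sets.top[of ?N] by (simp add: space_restrict_space)
  ultimately have "emeasure sphere_measure (sphere 0 1)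
      = 3 * emeasure ?M (ball 0 1 - {0} :: vec3 set)"
    by (simp add: sphere_measure_def emeasure_distr[OF m])
  also have "emeasure ?M (ball 0 1 - {0} :: vec3 set)
      = emeasure lborel (ball 0 1 - {0} :: vec3 set)"
    by (subst emeasure_restrict_space) auto
  also have "\<dots> = emeasure lborel (ball 0 1 :: vec3 set)"
    by (rule emeasure_Diff_null_set) auto
  also have "\<dots> = ennreal (4 / 3 * pi)"
    by (simp add: emeasure_ball unit_ball_vol_3)
  also have "3 * ennreal (4 / 3 * pi) = ennreal (4 * pi)"
    by (subst ennreal_numeral[symmetric], subst ennreal_mult[symmetric]) auto
  finally show ?thesis .
qed


text \<open>
  The collision operator \<open>Q[F,F;F](v)\<close>, with \<open>f = F(t,x,\<cdot>)\<close>. The integrals are Bochner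
  integrals, which return \<open>0\<close> on non-integrable functions; for densities bounded by a
  Gaussian in \<open>v\<close>, in particular for all mild solutions below, they converge absolutely.
\<close>

definition post_u :: "vec3 \<Rightarrow> vec3 \<Rightarrow> vec3 \<Rightarrow> vec3" where
  "post_u v u \<omega> = u + (\<omega> \<bullet> (v - u)) *\<^sub>R \<omega>"

definition post_v :: "vec3 \<Rightarrow> vec3 \<Rightarrow> vec3 \<Rightarrow> vec3" where
  "post_v v u \<omega> = v - (\<omega> \<bullet> (v - u)) *\<^sub>R \<omega>"

definition collision :: "real \<Rightarrow> (vec3 \<Rightarrow> real) \<Rightarrow> vec3 \<Rightarrow> real" where
  "collision \<theta> f v =
     (LINT u|lborel. LINT \<omega>|sphere_measure.
        \<bar>\<omega> \<bullet> (v - u)\<bar> *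
        (f (post_u v u \<omega>) * f (post_v v u \<omega>) * (1 + \<theta> * f u + \<theta> * f v)
         - f u * f v * (1 + \<theta> * f (post_u v u \<omega>) + \<theta> * f (post_v v u \<omega>))))"

definition Q :: "real \<Rightarrow> density \<Rightarrow> density" where
  "Q \<theta> F t x v = collision \<theta> (F t x) v"

definition sharp :: "density \<Rightarrow> density" where
  "sharp F t x v = F t (x + t *\<^sub>R v) v"


definition gauss_space :: "real \<Rightarrow> density set" where
  "gauss_space \<beta> =
     {F. continuous_on ({0..} \<times> UNIV \<times> UNIV) (\<lambda>(t, x, v). F t x v) \<and>
         (\<exists>c>0. \<forall>t\<ge>0. \<forall>x v. \<bar>F t x v\<bar> \<le> c * exp (- \<beta> * ((norm x)\<^sup>2 + (norm v)\<^sup>2)))}"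

text \<open>On elements of \<open>gauss_space \<beta>\<close> the supremum is over a bounded set.\<close>

definition gauss_norm :: "real \<Rightarrow> density \<Rightarrow> real" where
  "gauss_norm \<beta> F =
     (SUP (t, x, v) \<in> {0..} \<times> UNIV \<times> UNIV. exp (\<beta> * ((norm x)\<^sup>2 + (norm v)\<^sup>2)) * \<bar>F t x v\<bar>)"

definition gauss_ball :: "real \<Rightarrow> real \<Rightarrow> density set" where
  "gauss_ball \<beta> R = {F \<in> gauss_space \<beta>. gauss_norm \<beta> F \<le> R}"


text \<open>
  The Gaussian bound defining the solution class is imposed along characteristics, i.e. on
  \<open>sharp F\<close>, the unknown of the mild equation. Imposed on \<open>F\<close> itself, uniformly in time,
  it would exclude every nonzero nonnegative solution: by conservation of mass, momentum
  and energy, the second spatial moment of \<open>F(t)\<close> is that of \<open>F\<^sub>0(x - t v, v)\<close>, which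
  grows like \<open>t\<^sup>2\<close>.
\<close>

definition mild_solution :: "real \<Rightarrow> real \<Rightarrow> (vec3 \<Rightarrow> vec3 \<Rightarrow> real) \<Rightarrow> density \<Rightarrow> bool" where
  "mild_solution \<theta> \<beta> F0 F \<longleftrightarrow>
     sharp F \<in> gauss_space \<beta> \<and>
     (\<forall>t\<ge>0. \<forall>x v. sharp F t x v = F0 x v + (LINT \<tau>:{0..t}|lborel. sharp (Q \<theta> F) \<tau> x v))"

definition nonneg_mild_solution_in_ball ::
    "real \<Rightarrow> real \<Rightarrow> real \<Rightarrow> (vec3 \<Rightarrow> vec3 \<Rightarrow> real) \<Rightarrow> density \<Rightarrow> bool" where
  "nonneg_mild_solution_in_ball \<theta> \<beta> R F0 F \<longleftrightarrow>
     mild_solution \<theta> \<beta> F0 F \<and> sharp F \<in> gauss_ball \<beta> R \<and> (\<forall>t\<ge>0. \<forall>x v. 0 \<le> F t x v)"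

end

theory Submission
  imports Defs "HOL-Probability.Distributions"
begin

text \<open>
  The unknown is \<open>h = sharp F\<close>. Collisions conserve energy and keep the sum of the squared
  distances of the two characteristics from the origin, so gain and loss are both
  controlled by \<open>\<bar>v - u\<bar> exp (- \<beta> (\<bar>x\<bar>\<^sup>2 + \<bar>v\<bar>\<^sup>2 + \<bar>u\<bar>\<^sup>2 + \<bar>x + \<tau> (v - u)\<bar>\<^sup>2))\<close>. Integration in \<open>\<tau>\<close> cancels
  the factor \<open>\<bar>v - u\<bar>\<close>, and the Picard map is a contraction of the ball of radius \<open>R\<close> with
  constant \<open>48 pi\<^sup>3 (R + R\<^sup>2) / \<beta>\<^sup>2\<close>.

  The Picard map does not preserve positivity. It is therefore applied to a modified
  collision term in which \<open>F\<close> is replaced by \<open>\<bar>F\<bar>\<close> everywhere except in the factor \<open>F(v)\<close> of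
  the loss term. The estimates are unchanged, the modified term is nonnegative wherever
  \<open>F(v) \<le> 0\<close>, so its fixed point is nonnegative and solves the original equation; and
  nonnegative solutions of the original equation are fixed points of the modified map.
\<close>

subsection \<open>Gaussian integrals and integrals depending on a parameter\<close>

text \<open>Dominated convergence along sequences. The majorant separates as
  \<open>c p * g y\<close>, so continuity of \<open>c\<close> makes it uniform near a given point.
  Continuity of the integrand is asked only almost everywhere because a time cutoff jumps at its
  endpoint.\<close>

lemma continuous_on_lebesgue_integral:
  fixes f :: "'a::metric_space \<Rightarrow> 'b \<Rightarrow> real"
  assumes meas: "\<And>p. f p \<in> borel_measurable M"
    and cont: "\<And>p. AE y in M. isCont (\<lambda>p. f p y) p"
    and c: "continuous_on UNIV c"
    and g: "integrable M g" "\<And>y. y \<in> space M \<Longrightarrow> 0 \<le> g y"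
    and dom: "\<And>p y. y \<in> space M \<Longrightarrow> \<bar>f p y\<bar> \<le> c p * g y"
  shows "continuous_on UNIV (\<lambda>p. LINT y|M. f p y)"
proof -
  have "((\<lambda>n. LINT y|M. f (X n) y) \<longlonglongrightarrow> (LINT y|M. f p y))" if X: "X \<longlonglongrightarrow> p" for X p
  proof -
    \<comment> \<open>From some index \<open>N\<close> on, \<open>c (X n)\<close> stays below
      \<open>c p + 1\<close>, so the sequence shifted by \<open>N\<close> has a single integrable
      majorant.\<close>
    have "(\<lambda>n. c (X n)) \<longlonglongrightarrow> c p"
      using c X isCont_tendsto_compose[of p c X] by (simp add: continuous_on_eq_continuous_at)
    then have "eventually (\<lambda>n. c (X n) < c p + 1) sequentially"
      by (rule order_tendstoD) simp
    then obtain N where N: "\<And>n. n \<ge> N \<Longrightarrow> c (X n) < c p + 1"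
      by (auto simp: eventually_sequentially)
    have "(\<lambda>n. LINT y|M. f (X (n + N)) y) \<longlonglongrightarrow> (LINT y|M. f p y)"
    proof (rule integral_dominated_convergence[where w = "\<lambda>y. (c p + 1) * g y"])
      show "AE y in M. (\<lambda>n. f (X (n + N)) y) \<longlonglongrightarrow> f p y"
        using cont[of p]
        by eventually_elim (rule isCont_tendsto_compose[OF _ LIMSEQ_ignore_initial_segment[OF X]])
      show "AE y in M. norm (f (X (n + N)) y) \<le> (c p + 1) * g y" for n
      proof (rule AE_I2)
        fix y assume y: "y \<in> space M"
        have "c (X (n + N)) * g y \<le> (c p + 1) * g y"
          using N[of "n + N"] g(2)[OF y] by (intro mult_right_mono) auto
        then show "norm (f (X (n + N)) y) \<le> (c p + 1) * g y"
          using dom[OF y, of "X (n + N)"] by simp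
      qed
    qed (use meas g in auto)
    then show ?thesis by (rule LIMSEQ_offset)
  qed
  then show ?thesis
    by (auto simp: continuous_on_sequentially comp_def)
qed

lemma nn_integral_gaussian_real:
  assumes "0 < \<beta>"
  shows "(\<integral>\<^sup>+x. ennreal (exp (- \<beta> * (x - c)\<^sup>2)) \<partial>lborel) = ennreal (sqrt (pi / \<beta>))"
proof -
  \<comment> \<open>The normal density of variance 1/(2 \<beta>) has exactly the exponent -\<beta>
    (x - c)^2.\<close>
  define \<sigma> where "\<sigma> = sqrt (1 / (2 * \<beta>))"
  have \<sigma>: "0 < \<sigma>" "\<sigma>\<^sup>2 = 1 / (2 * \<beta>)"
    using assms by (auto simp: \<sigma>_def)
  have "exp (- \<beta> * (x - c)\<^sup>2) = sqrt (pi / \<beta>) * normal_density c \<sigma> x" for x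
    using assms by (simp add: normal_density_def \<sigma> field_simps real_sqrt_divide)
  then have "(\<integral>\<^sup>+x. ennreal (exp (- \<beta> * (x - c)\<^sup>2)) \<partial>lborel)
      = (\<integral>\<^sup>+x. ennreal (sqrt (pi / \<beta>) * normal_density c \<sigma> x) \<partial>lborel)"
    by simp
  also have "\<dots> = ennreal (LINT x|lborel. sqrt (pi / \<beta>) * normal_density c \<sigma> x)"
    using \<sigma> assms by (intro nn_integral_eq_integral) auto
  also have "\<dots> = ennreal (sqrt (pi / \<beta>))"
    using \<sigma> by simp
  finally show ?thesis .
qed

lemma nn_integral_gaussian_vec3:
  assumes "0 < \<beta>"
  shows "(\<integral>\<^sup>+u. ennreal (exp (- \<beta> * (norm (u::vec3))\<^sup>2)) \<partial>lborel) = ennreal (sqrt (pi / \<beta>) ^ 3)"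
proof -
  have "exp (- \<beta> * (norm u)\<^sup>2) = (\<Prod>b\<in>Basis. exp (- \<beta> * (u \<bullet> b - 0)\<^sup>2))" for u :: vec3
  proof -
    have "(norm u)\<^sup>2 = (\<Sum>b\<in>Basis. (u \<bullet> b)\<^sup>2)"
      unfolding power2_norm_eq_inner euclidean_inner[of u u] by (simp only: power2_eq_square)
    then show ?thesis
      by (simp add: exp_sum sum_distrib_left flip: sum_negf)
  qed
  then have "(\<integral>\<^sup>+u. ennreal (exp (- \<beta> * (norm (u::vec3))\<^sup>2)) \<partial>lborel)
      = (\<integral>\<^sup>+u. (\<Prod>b\<in>Basis. ennreal (exp (- \<beta> * ((u::vec3) \<bullet> b - 0)\<^sup>2))) \<partial>lborel)"
    by (simp add: prod_ennreal)
  also have "\<dots> = (\<Prod>b\<in>(Basis::vec3 set). \<integral>\<^sup>+x. ennreal (exp (- \<beta> * (x - 0)\<^sup>2)) \<partial>lborel)"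
    by (subst nn_integral_lborel_prod) auto
  also have "\<dots> = ennreal (sqrt (pi / \<beta>) ^ 3)"
    unfolding nn_integral_gaussian_real[OF assms] by (simp add: ennreal_power assms less_imp_le)
  finally show ?thesis .
qed

text \<open>Half of the Gaussian exponent is given up to absorb the linear factor.\<close>

lemma integrable_gaussian_moment:
  assumes "0 < \<beta>"
  shows "integrable lborel (\<lambda>u::vec3. (1 + norm u) * exp (- \<beta> * (norm u)\<^sup>2))"
proof (rule Bochner_Integration.integrable_bound)
  show "integrable lborel (\<lambda>u::vec3. (2 + 2 / \<beta>) * exp (- (\<beta> / 2) * (norm u)\<^sup>2))"
    using nn_integral_gaussian_vec3[of "\<beta> / 2"] assms
    by (intro integrable_mult_right integrableI_bounded) auto
  show "AE u in lborel. norm ((1 + norm u) * exp (- \<beta> * (norm u)\<^sup>2))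
      \<le> norm ((2 + 2 / \<beta>) * exp (- (\<beta> / 2) * (norm (u::vec3))\<^sup>2))"
  proof (rule AE_I2)
    fix u :: vec3
    define r where "r = norm u"
    have r: "0 \<le> r" by (simp add: r_def)
    \<comment> \<open>The right-hand side is (2 + 2/\<beta>) (1 + (\<beta>/2) r^2) multiplied out, a
      form to which 1 + y \<le> exp y applies.\<close>
    have "1 + r \<le> 2 + \<beta> * r\<^sup>2 + 2 / \<beta> + r\<^sup>2"
    proof -
      have "0 \<le> (r - 1 / 2)\<^sup>2" "0 \<le> \<beta> * r\<^sup>2" "0 \<le> 2 / \<beta>"
        using assms by auto
      moreover have "(r - 1 / 2)\<^sup>2 = r\<^sup>2 - r + 1 / 4"
        by (simp add: power2_eq_square algebra_simps)
      ultimately show ?thesis by linarith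
    qed
    also have "\<dots> = (2 + 2 / \<beta>) * (1 + (\<beta> / 2) * r\<^sup>2)"
      using assms by (simp add: field_simps)
    also have "\<dots> \<le> (2 + 2 / \<beta>) * exp ((\<beta> / 2) * r\<^sup>2)"
      using assms by (intro mult_left_mono exp_ge_add_one_self) auto
    finally have "(1 + r) * exp (- \<beta> * r\<^sup>2) \<le> (2 + 2 / \<beta>) * exp ((\<beta> / 2) * r\<^sup>2) * exp (- \<beta> * r\<^sup>2)"
      by (rule mult_right_mono) simp
    also have "\<dots> = (2 + 2 / \<beta>) * exp (- (\<beta> / 2) * r\<^sup>2)"
      by (simp add: mult.assoc flip: exp_add)
    finally show "norm ((1 + norm u) * exp (- \<beta> * (norm u)\<^sup>2))
      \<le> norm ((2 + 2 / \<beta>) * exp (- (\<beta> / 2) * (norm u)\<^sup>2))"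
      using r assms by (simp add: abs_mult flip: r_def)
  qed
qed simp

text \<open>The component of \<open>x + \<tau> w\<close> along \<open>w\<close> runs through the real line at speed \<open>norm w\<close>.\<close>
lemma nn_integral_gaussian_line:
  fixes x w :: "'a::real_inner"
  assumes "0 < \<beta>"
  shows "ennreal (norm w) * (\<integral>\<^sup>+\<tau>. ennreal (exp (- \<beta> * (norm (x + \<tau> *\<^sub>R w))\<^sup>2)) \<partial>lborel)
    \<le> ennreal (sqrt (pi / \<beta>))"
proof (cases "w = 0")
  case False
  define r where "r = norm w"
  \<comment> \<open>With this \<open>c\<close>, \<open>r * \<tau> - c\<close> is the component of x
    + \<tau> w along w, which Cauchy-Schwarz bounds by the norm. The leading \<open>0 +\<close>
    below fits the pattern of the affine substitution.\<close>
  define c where "c = - (x \<bullet> w) / r"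
  have r: "0 < r" using False by (simp add: r_def)
  have le: "exp (- \<beta> * (norm (x + \<tau> *\<^sub>R w))\<^sup>2) \<le> exp (- \<beta> * (0 + r * \<tau> - c)\<^sup>2)" for \<tau>
  proof -
    have "0 + r * \<tau> - c = ((x + \<tau> *\<^sub>R w) \<bullet> w) / r"
      using r by (simp add: c_def inner_add_left dot_square_norm r_def field_simps power2_eq_square)
    moreover have "\<bar>((x + \<tau> *\<^sub>R w) \<bullet> w) / r\<bar> \<le> norm (x + \<tau> *\<^sub>R w)"
      using Cauchy_Schwarz_ineq2[of "x + \<tau> *\<^sub>R w" w] r
      by (simp add: r_def field_simps)
    ultimately have "(0 + r * \<tau> - c)\<^sup>2 \<le> (norm (x + \<tau> *\<^sub>R w))\<^sup>2"
      by (metis abs_le_square_iff abs_norm_cancel)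
    then show ?thesis using assms by simp
  qed
  have "ennreal r * (\<integral>\<^sup>+\<tau>. ennreal (exp (- \<beta> * (norm (x + \<tau> *\<^sub>R w))\<^sup>2)) \<partial>lborel)
      \<le> ennreal \<bar>r\<bar> * (\<integral>\<^sup>+\<tau>. ennreal (exp (- \<beta> * (0 + r * \<tau> - c)\<^sup>2)) \<partial>lborel)"
    using r le by (intro mult_mono nn_integral_mono ennreal_leI) auto
  also have "\<dots> = (\<integral>\<^sup>+\<tau>. ennreal (exp (- \<beta> * (\<tau> - c)\<^sup>2)) \<partial>lborel)"
    using r by (intro nn_integral_real_affine[symmetric]) auto
  also have "\<dots> = ennreal (sqrt (pi / \<beta>))"
    by (rule nn_integral_gaussian_real[OF assms])
  finally show ?thesis by (simp add: r_def)
qed simp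

text \<open>By Tonelli, time is integrated first at fixed u: the line integral cancels
  \<open>norm (v - u)\<close> and leaves one factor sqrt(pi/\<beta>), and the Gaussian in u
  contributes three more. The bound is uniform in x and v.\<close>

lemma nn_integral_collision_frequency:
  fixes x v :: vec3
  assumes "0 < \<beta>"
  shows "(\<integral>\<^sup>+\<tau>. (\<integral>\<^sup>+u. ennreal (norm (v - u) *
      exp (- \<beta> * ((norm (x + \<tau> *\<^sub>R (v - u)))\<^sup>2 + (norm u)\<^sup>2))) \<partial>lborel) \<partial>lborel)
    \<le> ennreal (pi\<^sup>2 / \<beta>\<^sup>2)"
proof -
  let ?G = "\<lambda>u::vec3. exp (- \<beta> * (norm u)\<^sup>2)"
  have eq: "norm (v - u) * exp (- \<beta> * ((norm (x + \<tau> *\<^sub>R (v - u)))\<^sup>2 + (norm u)\<^sup>2))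
      = ?G u * (norm (v - u) * ?G (x + \<tau> *\<^sub>R (v - u)))" for \<tau> u
    by (simp add: ring_distribs exp_diff exp_minus divide_inverse mult_ac)
  have "(\<integral>\<^sup>+\<tau>. (\<integral>\<^sup>+u. ennreal (norm (v - u) *
      exp (- \<beta> * ((norm (x + \<tau> *\<^sub>R (v - u)))\<^sup>2 + (norm u)\<^sup>2))) \<partial>lborel) \<partial>lborel)
    = (\<integral>\<^sup>+u. (\<integral>\<^sup>+\<tau>. ennreal (?G u * (norm (v - u) * ?G (x + \<tau> *\<^sub>R (v - u)))) \<partial>lborel) \<partial>lborel)"
    unfolding eq by (rule lborel_pair.Fubini') measurable
  also have "\<dots> = (\<integral>\<^sup>+u. ennreal (?G u) * (ennreal (norm (v - u)) *
      (\<integral>\<^sup>+\<tau>. ennreal (?G (x + \<tau> *\<^sub>R (v - u))) \<partial>lborel)) \<partial>lborel)"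
    by (simp add: ennreal_mult nn_integral_cmult)
  also have "\<dots> \<le> (\<integral>\<^sup>+u. ennreal (?G u) * ennreal (sqrt (pi / \<beta>)) \<partial>lborel)"
    by (intro nn_integral_mono mult_left_mono nn_integral_gaussian_line assms) auto
  also have "\<dots> = ennreal (sqrt (pi / \<beta>) ^ 3) * ennreal (sqrt (pi / \<beta>))"
    by (subst nn_integral_multc) (simp_all only: nn_integral_gaussian_vec3[OF assms], simp)
  also have "\<dots> = ennreal (sqrt (pi / \<beta>) ^ 4)"
    using assms by (simp add: eval_nat_numeral flip: ennreal_mult)
  also have "sqrt (pi / \<beta>) ^ 4 = pi\<^sup>2 / \<beta>\<^sup>2"
  proof -
    have "sqrt (pi / \<beta>) ^ 4 = ((sqrt (pi / \<beta>))\<^sup>2)\<^sup>2" by simp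
    also have "\<dots> = pi\<^sup>2 / \<beta>\<^sup>2" using assms by (simp add: power_divide)
    finally show ?thesis .
  qed
  finally show ?thesis .
qed

section \<open>Integration over the unit sphere\<close>

lemma sets_sphere_measure: "sets sphere_measure = sets (restrict_space borel (sphere 0 1))"
  by (simp add: sphere_measure_def)

lemma borel_measurable_sphere_measure:
  assumes "f \<in> borel_measurable borel"
  shows "f \<in> borel_measurable sphere_measure"
  using measurable_restrict_space1[OF assms, of "sphere 0 1"] measurable_cong_sets[OF sets_sphere_measure refl]
  by blast

lemma measure_sphere_measure: "measure sphere_measure (space sphere_measure) = 4 * pi"
  by (simp add: measure_def space_sphere_measure emeasure_sphere_measure)

lemma finite_measure_sphere_measure: "finite_measure sphere_measure"
  by (rule finite_measureI) (simp add: space_sphere_measure emeasure_sphere_measure)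

lemma abs_integral_sphere_le:
  assumes "integrable sphere_measure f" "\<And>\<omega>. \<omega> \<in> space sphere_measure \<Longrightarrow> \<bar>f \<omega>\<bar> \<le> B"
  shows "\<bar>LINT \<omega>|sphere_measure. f \<omega>\<bar> \<le> 4 * pi * B"
proof -
  have "\<bar>LINT \<omega>|sphere_measure. f \<omega>\<bar> \<le> (LINT \<omega>|sphere_measure. \<bar>f \<omega>\<bar>)"
    by (rule integral_abs_bound)
  also have "\<dots> \<le> (LINT \<omega>|sphere_measure. B)"
    using assms finite_measure.integrable_const[OF finite_measure_sphere_measure]
    by (intro integral_mono) auto
  also have "\<dots> = 4 * pi * B"
    by (simp add: measure_sphere_measure)
  finally show ?thesis .
qed

subsection \<open>The collision kernel\<close>

text \<open>The integrand of the modified collision term at \<theta> = 1. Only the factor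
  \<open>f v\<close> of the loss product keeps its sign; on nonnegative \<open>f\<close> this is the
  integrand of \<open>collision 1\<close>.\<close>

definition signed_kernel :: "(vec3 \<Rightarrow> real) \<Rightarrow> vec3 \<Rightarrow> vec3 \<Rightarrow> vec3 \<Rightarrow> real" where
  "signed_kernel f v u \<omega> =
     \<bar>\<omega> \<bullet> (v - u)\<bar> *
     (\<bar>f (post_u v u \<omega>)\<bar> * \<bar>f (post_v v u \<omega>)\<bar> * (1 + \<bar>f u\<bar> + \<bar>f v\<bar>)
      - \<bar>f u\<bar> * f v * (1 + \<bar>f (post_u v u \<omega>)\<bar> + \<bar>f (post_v v u \<omega>)\<bar>))"

lemma signed_kernel_nonneg:
  assumes "f v \<le> 0"
  shows "0 \<le> signed_kernel f v u \<omega>"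
proof -
  have "\<bar>f u\<bar> * f v * (1 + \<bar>f (post_u v u \<omega>)\<bar> + \<bar>f (post_v v u \<omega>)\<bar>) \<le> 0"
    using assms by (intro mult_nonpos_nonneg mult_nonneg_nonpos) auto
  moreover have "0 \<le> \<bar>f (post_u v u \<omega>)\<bar> * \<bar>f (post_v v u \<omega>)\<bar> * (1 + \<bar>f u\<bar> + \<bar>f v\<bar>)"
    by simp
  ultimately show ?thesis
    unfolding signed_kernel_def by (intro mult_nonneg_nonneg) linarith+
qed

text \<open>The weight exp(-\<beta> (|y|^2 + |w|^2)) at the foot y of the characteristic with
  velocity w that passes through x + \<tau> v at time \<tau>.\<close>

definition maxwellian :: "real \<Rightarrow> real \<Rightarrow> vec3 \<Rightarrow> vec3 \<Rightarrow> vec3 \<Rightarrow> real" where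
  "maxwellian \<beta> \<tau> x v w = exp (- \<beta> * ((norm (x + \<tau> *\<^sub>R (v - w)))\<^sup>2 + (norm w)\<^sup>2))"

lemma maxwellian_pos: "0 < maxwellian \<beta> \<tau> x v w"
  by (simp add: maxwellian_def)

lemma maxwellian_le_1: "0 < \<beta> \<Longrightarrow> maxwellian \<beta> \<tau> x v w \<le> 1"
  by (simp add: maxwellian_def)

lemma maxwellian_diag: "maxwellian \<beta> \<tau> x v v = exp (- \<beta> * ((norm x)\<^sup>2 + (norm v)\<^sup>2))"
  by (simp add: maxwellian_def)

text \<open>
  Besides \<open>\<bar>u\<bar>\<^sup>2 + \<bar>v\<bar>\<^sup>2\<close>, a collision preserves \<open>\<bar>x + \<tau> (v - u)\<bar>\<^sup>2 + \<bar>x\<bar>\<^sup>2\<close>, because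
  \<open>v - u'\<close> and \<open>v - v'\<close> are the orthogonal components of \<open>v - u\<close>.
\<close>
lemma maxwellian_post:
  assumes "norm \<omega> = 1"
  shows "maxwellian \<beta> \<tau> x v (post_u v u \<omega>) * maxwellian \<beta> \<tau> x v (post_v v u \<omega>)
    = maxwellian \<beta> \<tau> x v u * maxwellian \<beta> \<tau> x v v"
proof -
  define w where "w = v - u"
  define a where "a = \<omega> \<bullet> w"
  have \<omega>: "\<omega> \<bullet> \<omega> = 1"
    using assms by (simp add: norm_eq_1)
  have v: "v = u + w" by (simp add: w_def)
  have wo: "w \<bullet> \<omega> = a" and wo': "\<omega> \<bullet> w = a" by (simp_all add: a_def inner_commute)
  have energy: "(norm (u + a *\<^sub>R \<omega>))\<^sup>2 + (norm (v - a *\<^sub>R \<omega>))\<^sup>2 = (norm u)\<^sup>2 + (norm v)\<^sup>2"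
    unfolding power2_norm_eq_inner v
    by (simp add: inner_simps inner_commute wo wo' \<omega>) (simp add: algebra_simps)
  have "(norm (x + \<tau> *\<^sub>R (w - a *\<^sub>R \<omega>)))\<^sup>2 + (norm (x + \<tau> *\<^sub>R (a *\<^sub>R \<omega>)))\<^sup>2
      = (norm (x + \<tau> *\<^sub>R w))\<^sup>2 + (norm x)\<^sup>2"
    unfolding power2_norm_eq_inner
    by (simp add: inner_simps inner_commute wo wo' \<omega>) (simp add: algebra_simps)
  moreover have "v - (u + a *\<^sub>R \<omega>) = w - a *\<^sub>R \<omega>" "v - (v - a *\<^sub>R \<omega>) = a *\<^sub>R \<omega>" "v - u = w"
    by (auto simp: w_def)
  ultimately have "((norm (x + \<tau> *\<^sub>R (v - (u + a *\<^sub>R \<omega>))))\<^sup>2 + (norm (u + a *\<^sub>R \<omega>))\<^sup>2)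
      + ((norm (x + \<tau> *\<^sub>R (v - (v - a *\<^sub>R \<omega>))))\<^sup>2 + (norm (v - a *\<^sub>R \<omega>))\<^sup>2)
      = ((norm (x + \<tau> *\<^sub>R (v - u)))\<^sup>2 + (norm u)\<^sup>2) + ((norm x)\<^sup>2 + (norm v)\<^sup>2)"
    using energy by (simp only:)
  then have "- \<beta> * ((norm (x + \<tau> *\<^sub>R (v - (u + a *\<^sub>R \<omega>))))\<^sup>2 + (norm (u + a *\<^sub>R \<omega>))\<^sup>2)
      + - \<beta> * ((norm (x + \<tau> *\<^sub>R (v - (v - a *\<^sub>R \<omega>))))\<^sup>2 + (norm (v - a *\<^sub>R \<omega>))\<^sup>2)
      = - \<beta> * ((norm (x + \<tau> *\<^sub>R (v - u)))\<^sup>2 + (norm u)\<^sup>2) + - \<beta> * ((norm x)\<^sup>2 + (norm v)\<^sup>2)"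
    unfolding distrib_left[symmetric] by simp
  then show ?thesis
    unfolding maxwellian_diag
    unfolding maxwellian_def post_u_def post_v_def a_def w_def exp_add[symmetric]
    by (rule arg_cong)
qed

text \<open>The factors are exchanged one at a time. The first two carry the weights k and l, so
  every term keeps the full weight k l; the constant is 2 R (1 + 2 R) + 2 R^2.\<close>

lemma abs_triple_prod_diff_le:
  fixes p q s p' q' s' :: real
  assumes "\<bar>q\<bar> \<le> R * l" "\<bar>p'\<bar> \<le> R * k" "\<bar>q'\<bar> \<le> R * l" "\<bar>s\<bar> \<le> 1 + 2 * R"
    and "\<bar>p - p'\<bar> \<le> D * k" "\<bar>q - q'\<bar> \<le> D * l" "\<bar>s - s'\<bar> \<le> 2 * D"
    and "0 \<le> R" "0 \<le> D" "0 \<le> k" "0 \<le> l"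
  shows "\<bar>p * q * s - p' * q' * s'\<bar> \<le> D * (2 * R + 6 * R\<^sup>2) * (k * l)"
proof -
  have "p * q * s - p' * q' * s' = (p - p') * q * s + p' * (q - q') * s + p' * q' * (s - s')"
    by (simp add: algebra_simps)
  also have "\<bar>\<dots>\<bar> \<le> \<bar>p - p'\<bar> * \<bar>q\<bar> * \<bar>s\<bar> + \<bar>p'\<bar> * \<bar>q - q'\<bar> * \<bar>s\<bar> + \<bar>p'\<bar> * \<bar>q'\<bar> * \<bar>s - s'\<bar>"
    unfolding abs_mult[symmetric]
    by (rule order_trans[OF abs_triangle_ineq add_right_mono[OF abs_triangle_ineq]])
  also have "\<dots> \<le> (D * k) * (R * l) * (1 + 2 * R) + (R * k) * (D * l) * (1 + 2 * R)
      + (R * k) * (R * l) * (2 * D)"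
    by (intro add_mono mult_mono mult_nonneg_nonneg assms abs_ge_zero)
  also have "\<dots> = D * (2 * R + 6 * R\<^sup>2) * (k * l)"
    by (simp add: algebra_simps power2_eq_square)
  finally show ?thesis .
qed

text \<open>Gain and loss are both two weighted factors times a bounded statistical factor. By
  \<open>eq\<close> both carry the weight \<open>m u * m v\<close>, and 2 (2 R + 6 R^2) \<le> 12 (R
  + R^2) gives the constant.\<close>

lemma signed_kernel_lipschitz:
  assumes f: "\<And>w. \<bar>f w\<bar> \<le> R * m w" and g: "\<And>w. \<bar>g w\<bar> \<le> R * m w"
    and d: "\<And>w. \<bar>f w - g w\<bar> \<le> D * m w"
    and m: "\<And>w. 0 \<le> m w" "\<And>w. m w \<le> 1"
    and eq: "m (post_u v u \<omega>) * m (post_v v u \<omega>) = m u * m v"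
    and "norm \<omega> = 1" "0 \<le> R" "0 \<le> D"
  shows "\<bar>signed_kernel f v u \<omega> - signed_kernel g v u \<omega>\<bar>
    \<le> 12 * D * (R + R\<^sup>2) * (norm (v - u) * (m u * m v))"
proof -
  let ?a = "post_u v u \<omega>" and ?b = "post_v v u \<omega>"
  \<comment> \<open>Since \<open>m\<close> is at most 1, the weight may be dropped; the statistical
    factors need only these unweighted bounds.\<close>
  have 1: "\<bar>f w\<bar> \<le> R" "\<bar>g w\<bar> \<le> R" "\<bar>f w - g w\<bar> \<le> D" for w
    using order_trans[OF f mult_left_le[OF m(2)[of w], of R]] order_trans[OF g mult_left_le[OF m(2)[of w], of R]]
      order_trans[OF d mult_left_le[OF m(2)[of w], of D]] assms by auto
  have ad: "\<bar>\<bar>f w\<bar> - \<bar>g w\<bar>\<bar> \<le> D * m w" for w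
    using d[of w] by linarith
  have af: "\<bar>\<bar>f w\<bar>\<bar> \<le> R * m w" and ag: "\<bar>\<bar>g w\<bar>\<bar> \<le> R * m w" for w
    using f g by auto
  have s: "\<bar>1 + \<bar>f w\<bar> + \<bar>f w'\<bar>\<bar> \<le> 1 + 2 * R"
    "\<bar>(1 + \<bar>f w\<bar> + \<bar>f w'\<bar>) - (1 + \<bar>g w\<bar> + \<bar>g w'\<bar>)\<bar> \<le> 2 * D" for w w'
  proof -
    have "\<bar>1 + a + b\<bar> \<le> 1 + 2 * R" if "0 \<le> a" "a \<le> R" "0 \<le> b" "b \<le> R" for a b
      using that by linarith
    from this[OF abs_ge_zero 1(1) abs_ge_zero 1(1)]
    show "\<bar>1 + \<bar>f w\<bar> + \<bar>f w'\<bar>\<bar> \<le> 1 + 2 * R" .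
    have "\<bar>(1 + a + b) - (1 + a' + b')\<bar> \<le> 2 * D" if "\<bar>a - a'\<bar> \<le> D" "\<bar>b - b'\<bar> \<le> D" for a b a' b'
      using that by linarith
    then show "\<bar>(1 + \<bar>f w\<bar> + \<bar>f w'\<bar>) - (1 + \<bar>g w\<bar> + \<bar>g w'\<bar>)\<bar> \<le> 2 * D"
      by (meson 1(3) abs_triangle_ineq3 order_trans)
  qed
  have gain: "\<bar>\<bar>f ?a\<bar> * \<bar>f ?b\<bar> * (1 + \<bar>f u\<bar> + \<bar>f v\<bar>) - \<bar>g ?a\<bar> * \<bar>g ?b\<bar> * (1 + \<bar>g u\<bar> + \<bar>g v\<bar>)\<bar>
      \<le> D * (2 * R + 6 * R\<^sup>2) * (m ?a * m ?b)"
    by (rule abs_triple_prod_diff_le[OF af ag ag s(1) ad ad s(2) \<open>0 \<le> R\<close> \<open>0 \<le> D\<close> m(1) m(1)])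
  have loss: "\<bar>\<bar>f u\<bar> * f v * (1 + \<bar>f ?a\<bar> + \<bar>f ?b\<bar>) - \<bar>g u\<bar> * g v * (1 + \<bar>g ?a\<bar> + \<bar>g ?b\<bar>)\<bar>
      \<le> D * (2 * R + 6 * R\<^sup>2) * (m u * m v)"
    by (rule abs_triple_prod_diff_le[OF f ag g s(1) ad d s(2) \<open>0 \<le> R\<close> \<open>0 \<le> D\<close> m(1) m(1)])
  have B: "\<bar>\<omega> \<bullet> (v - u)\<bar> \<le> norm (v - u)"
    using Cauchy_Schwarz_ineq2[of \<omega> "v - u"] \<open>norm \<omega> = 1\<close> by simp
  have "\<bar>signed_kernel f v u \<omega> - signed_kernel g v u \<omega>\<bar> = \<bar>\<omega> \<bullet> (v - u)\<bar> *
    \<bar>(\<bar>f ?a\<bar> * \<bar>f ?b\<bar> * (1 + \<bar>f u\<bar> + \<bar>f v\<bar>) - \<bar>g ?a\<bar> * \<bar>g ?b\<bar> * (1 + \<bar>g u\<bar> + \<bar>g v\<bar>))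
      - (\<bar>f u\<bar> * f v * (1 + \<bar>f ?a\<bar> + \<bar>f ?b\<bar>) - \<bar>g u\<bar> * g v * (1 + \<bar>g ?a\<bar> + \<bar>g ?b\<bar>))\<bar>"
    unfolding signed_kernel_def right_diff_distrib[symmetric] abs_mult abs_idempotent
    by (simp add: algebra_simps)
  also have "\<dots> \<le> norm (v - u) * (2 * (D * (2 * R + 6 * R\<^sup>2) * (m u * m v)))"
    unfolding mult_2[of "D * (2 * R + 6 * R\<^sup>2) * (m u * m v)"]
    by (intro mult_mono B order_trans[OF abs_triangle_ineq4 add_mono[OF gain[unfolded eq] loss]]
        norm_ge_zero abs_ge_zero)
  also have "\<dots> \<le> norm (v - u) * ((12 * D * (R + R\<^sup>2)) * (m u * m v))"
  proof -
    have "2 * (2 * R + 6 * R\<^sup>2) \<le> 12 * (R + R\<^sup>2)"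
      using \<open>0 \<le> R\<close> by simp
    then have "D * (2 * (2 * R + 6 * R\<^sup>2)) \<le> D * (12 * (R + R\<^sup>2))"
      using \<open>0 \<le> D\<close> by (rule mult_left_mono)
    then have "(D * (2 * (2 * R + 6 * R\<^sup>2))) * (m u * m v) \<le> (D * (12 * (R + R\<^sup>2))) * (m u * m v)"
      using m by (intro mult_right_mono) auto
    then show ?thesis
      by (intro mult_left_mono) (auto simp: mult_ac)
  qed
  finally show ?thesis by (simp add: mult_ac)
qed

subsection \<open>The collision term along characteristics\<close>

text \<open>The counterpart of \<open>gauss_ball\<close> on all real times, with the norm bound
  stated pointwise; continuity on the whole space avoids relative topologies in time.\<close>

definition gauss_bounded :: "real \<Rightarrow> real \<Rightarrow> density \<Rightarrow> bool" where
  "gauss_bounded \<beta> R h \<longleftrightarrow>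
     continuous_on UNIV (\<lambda>(t, x, v). h t x v) \<and>
     (\<forall>t x v. \<bar>h t x v\<bar> \<le> R * exp (- \<beta> * ((norm x)\<^sup>2 + (norm v)\<^sup>2)))"

text \<open>If \<open>h = sharp F\<close>, then \<open>slice h \<tau> x v w = F \<tau> (x + \<tau> v) w\<close>.\<close>
definition slice :: "density \<Rightarrow> real \<Rightarrow> vec3 \<Rightarrow> vec3 \<Rightarrow> vec3 \<Rightarrow> real" where
  "slice h \<tau> x v w = h \<tau> (x + \<tau> *\<^sub>R (v - w)) w"

text \<open>The modified collision term along the characteristic. For \<open>h = sharp F\<close>
  with nonnegative \<open>F\<close> it is \<open>sharp (Q 1 F)\<close>.\<close>

definition signed_source :: "density \<Rightarrow> density" where
  "signed_source h \<tau> x v =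
     (LINT u|lborel. LINT \<omega>|sphere_measure. signed_kernel (slice h \<tau> x v) v u \<omega>)"

lemma gauss_boundedD:
  assumes "gauss_bounded \<beta> R h"
  shows "\<bar>h t x v\<bar> \<le> R * exp (- \<beta> * ((norm x)\<^sup>2 + (norm v)\<^sup>2))"
    and "\<bar>slice h \<tau> x v w\<bar> \<le> R * maxwellian \<beta> \<tau> x v w"
  using assms by (auto simp: gauss_bounded_def slice_def maxwellian_def)

lemma gauss_bounded_nonneg: "gauss_bounded \<beta> R h \<Longrightarrow> 0 \<le> R"
  using gauss_boundedD(1)[of \<beta> R h 0 0 0] by simp

lemma continuous_on_density:
  fixes h :: density
  assumes "continuous_on UNIV (\<lambda>(t, x, v). h t x v)"
    and "continuous_on S a" "continuous_on S b" "continuous_on S c"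
  shows "continuous_on S (\<lambda>p. h (a p) (b p) (c p))"
  using continuous_on_compose2[OF assms(1) continuous_on_Pair[OF assms(2) continuous_on_Pair[OF assms(3,4)]]]
  by simp

lemma continuous_on_signed_kernel:
  fixes h :: density
  assumes h: "continuous_on UNIV (\<lambda>(t, x, v). h t x v)"
    and "continuous_on S \<tau>" "continuous_on S x" "continuous_on S v" "continuous_on S u" "continuous_on S \<omega>"
  shows "continuous_on S (\<lambda>p. signed_kernel (slice h (\<tau> p) (x p) (v p)) (v p) (u p) (\<omega> p))"
  unfolding signed_kernel_def slice_def post_u_def post_v_def
  by (intro continuous_intros continuous_on_density[OF h] assms)

text \<open>The inner integral as a function of one tuple, so that joint continuity in all
  arguments, and with it measurability in u, can be stated.\<close>

definition sphere_average :: "density \<Rightarrow> real \<times> vec3 \<times> vec3 \<times> vec3 \<Rightarrow> real" where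
  "sphere_average h = (\<lambda>(\<tau>, x, v, u).
     LINT \<omega>|sphere_measure. signed_kernel (slice h \<tau> x v) v u \<omega>)"

lemma signed_source_eq: "signed_source h \<tau> x v = (LINT u|lborel. sphere_average h (\<tau>, x, v, u))"
  by (simp add: signed_source_def sphere_average_def)

context
  fixes \<beta> R :: real
  assumes \<beta>: "0 < \<beta>"
begin

lemma signed_kernel_slice_lipschitz:
  assumes h: "gauss_bounded \<beta> R h1" "gauss_bounded \<beta> R h2"
    and d: "\<And>t x v. \<bar>h1 t x v - h2 t x v\<bar> \<le> D * exp (- \<beta> * ((norm x)\<^sup>2 + (norm v)\<^sup>2))"
    and \<omega>: "\<omega> \<in> space sphere_measure"
  shows "\<bar>signed_kernel (slice h1 \<tau> x v) v u \<omega> - signed_kernel (slice h2 \<tau> x v) v u \<omega>\<bar>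
    \<le> 12 * D * (R + R\<^sup>2) * (norm (v - u) * (maxwellian \<beta> \<tau> x v u * maxwellian \<beta> \<tau> x v v))"
proof (rule signed_kernel_lipschitz)
  show "\<bar>slice h1 \<tau> x v w - slice h2 \<tau> x v w\<bar> \<le> D * maxwellian \<beta> \<tau> x v w" for w
    using d by (simp add: slice_def maxwellian_def)
  show "0 \<le> D"
    using d[of 0 0 0] by simp
  show "norm \<omega> = 1"
    using \<omega> by (simp add: space_sphere_measure)
  then show "maxwellian \<beta> \<tau> x v (post_u v u \<omega>) * maxwellian \<beta> \<tau> x v (post_v v u \<omega>)
      = maxwellian \<beta> \<tau> x v u * maxwellian \<beta> \<tau> x v v"
    by (rule maxwellian_post)
qed (use gauss_boundedD(2) h gauss_bounded_nonneg maxwellian_le_1[OF \<beta>] less_imp_le[OF maxwellian_pos] in auto)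

text \<open>The Lipschitz estimate against the zero density, whose kernel vanishes, with D = R. Of
  the two weights only the Gaussian in u is kept.\<close>

lemma signed_kernel_slice_bound:
  assumes h: "gauss_bounded \<beta> R h" and \<omega>: "\<omega> \<in> space sphere_measure"
  shows "\<bar>signed_kernel (slice h \<tau> x v) v u \<omega>\<bar> \<le> 12 * R * (R + R\<^sup>2) * (norm (v - u) * exp (- \<beta> * (norm u)\<^sup>2))"
proof -
  have R: "0 \<le> R" using h by (rule gauss_bounded_nonneg)
  have "gauss_bounded \<beta> R (\<lambda>_ _ _. 0)"
    using R by (simp add: gauss_bounded_def case_prod_beta)
  then have "\<bar>signed_kernel (slice h \<tau> x v) v u \<omega> - signed_kernel (slice (\<lambda>_ _ _. 0) \<tau> x v) v u \<omega>\<bar>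
    \<le> 12 * R * (R + R\<^sup>2) * (norm (v - u) * (maxwellian \<beta> \<tau> x v u * maxwellian \<beta> \<tau> x v v))"
    using gauss_boundedD(1)[OF h] by (intro signed_kernel_slice_lipschitz h \<omega>) auto
  also have "\<dots> \<le> 12 * R * (R + R\<^sup>2) * (norm (v - u) * (exp (- \<beta> * (norm u)\<^sup>2) * 1))"
    using R \<beta> maxwellian_le_1[OF \<beta>] less_imp_le[OF maxwellian_pos]
    by (intro mult_left_mono mult_mono) (auto simp: maxwellian_def)
  finally show ?thesis
    by (simp add: signed_kernel_def slice_def)
qed

section \<open>Regularity and bounds of the integrated collision term\<close>

lemma signed_kernel_sphere_measurable:
  assumes "gauss_bounded \<beta> R h"
  shows "(\<lambda>\<omega>. signed_kernel (slice h \<tau> x v) v u \<omega>) \<in> borel_measurable sphere_measure"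
  using assms by (intro borel_measurable_sphere_measure borel_measurable_continuous_onI
      continuous_on_signed_kernel continuous_intros) (auto simp: gauss_bounded_def)

lemma signed_kernel_sphere_integrable:
  assumes "gauss_bounded \<beta> R h"
  shows "integrable sphere_measure (\<lambda>\<omega>. signed_kernel (slice h \<tau> x v) v u \<omega>)"
proof (rule finite_measure.integrable_const_bound[OF finite_measure_sphere_measure])
  show "AE \<omega> in sphere_measure. norm (signed_kernel (slice h \<tau> x v) v u \<omega>)
      \<le> 12 * R * (R + R\<^sup>2) * (norm (v - u) * exp (- \<beta> * (norm u)\<^sup>2))"
    using signed_kernel_slice_bound[OF assms] by (intro AE_I2) simp
qed (rule signed_kernel_sphere_measurable[OF assms])

text \<open>The estimate |v - u| \<le> (1 + |v|) (1 + |u|) separates v from u, which produces the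
  product majorant required for continuity of the u-integral.\<close>

lemma sphere_average_bound:
  assumes "gauss_bounded \<beta> R h"
  shows "\<bar>sphere_average h (\<tau>, x, v, u)\<bar>
    \<le> 48 * pi * R * (R + R\<^sup>2) * (1 + norm v) * ((1 + norm u) * exp (- \<beta> * (norm u)\<^sup>2))"
proof -
  have R: "0 \<le> R" using assms by (rule gauss_bounded_nonneg)
  have "\<bar>sphere_average h (\<tau>, x, v, u)\<bar>
      \<le> 4 * pi * (12 * R * (R + R\<^sup>2) * (norm (v - u) * exp (- \<beta> * (norm u)\<^sup>2)))"
    unfolding sphere_average_def prod.case
    by (intro abs_integral_sphere_le signed_kernel_sphere_integrable signed_kernel_slice_bound assms)
  also have "\<dots> \<le> 4 * pi * (12 * R * (R + R\<^sup>2) * (((1 + norm v) * (1 + norm u)) * exp (- \<beta> * (norm u)\<^sup>2)))"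
  proof -
    have "norm (v - u) \<le> norm v + norm u"
      by (rule norm_triangle_ineq4)
    also have "\<dots> \<le> (1 + norm v) * (1 + norm u)"
      by (simp add: algebra_simps)
    finally show ?thesis
      using R by (intro mult_left_mono mult_right_mono) auto
  qed
  finally show ?thesis by (simp add: algebra_simps)
qed

lemma continuous_on_sphere_average:
  assumes h: "gauss_bounded \<beta> R h"
  shows "continuous_on UNIV (sphere_average h)"
proof -
  have "continuous_on UNIV (\<lambda>p. LINT \<omega>|sphere_measure.
      signed_kernel (slice h (fst p) (fst (snd p)) (fst (snd (snd p)))) (fst (snd (snd p))) (snd (snd (snd p))) \<omega>)"
  \<comment> \<open>The sphere has finite mass, so a constant is integrable and \<open>c\<close> can
    carry the whole bound.\<close>
  proof (rule continuous_on_lebesgue_integral[where g = "\<lambda>_. 1" and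
        c = "\<lambda>p. 12 * R * (R + R\<^sup>2) * (norm (fst (snd (snd p)) - snd (snd (snd p))) *
          exp (- \<beta> * (norm (snd (snd (snd p))))\<^sup>2))"], goal_cases)
    case 2
    show ?case
    proof (rule AE_I2)
      fix p :: "real \<times> vec3 \<times> vec3 \<times> vec3" and \<omega>
      have "continuous_on UNIV (\<lambda>p. signed_kernel
          (slice h (fst p) (fst (snd p)) (fst (snd (snd p)))) (fst (snd (snd p))) (snd (snd (snd p))) \<omega>)"
        using h by (intro continuous_on_signed_kernel continuous_intros) (auto simp: gauss_bounded_def)
      then show "isCont (\<lambda>p. signed_kernel
          (slice h (fst p) (fst (snd p)) (fst (snd (snd p)))) (fst (snd (snd p))) (snd (snd (snd p))) \<omega>) p"
        unfolding continuous_on_eq_continuous_at[OF open_UNIV] by blast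
    qed
  next
    case 3
    show ?case by (intro continuous_intros)
  next
    case 6
    then show ?case using signed_kernel_slice_bound[OF h] by simp
  qed (rule signed_kernel_sphere_measurable[OF h]
      finite_measure.integrable_const[OF finite_measure_sphere_measure] zero_le_one)+
  then show ?thesis
    by (simp add: sphere_average_def case_prod_beta)
qed

lemma continuous_on_sphere_average':
  assumes "gauss_bounded \<beta> R h" "continuous_on S f"
  shows "continuous_on S (\<lambda>p. sphere_average h (f p))"
  using continuous_on_compose2[OF continuous_on_sphere_average[OF assms(1)] assms(2)] by auto

lemma sphere_average_measurable:
  assumes "gauss_bounded \<beta> R h"
  shows "(\<lambda>u. sphere_average h (\<tau>, x, v, u)) \<in> borel_measurable lborel"
  using borel_measurable_continuous_onI[OF continuous_on_sphere_average'[OF assms, of UNIV "\<lambda>u. (\<tau>, x, v, u)"]]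
  by (simp add: continuous_intros)

lemma sphere_average_integrable:
  assumes "gauss_bounded \<beta> R h"
  shows "integrable lborel (\<lambda>u. sphere_average h (\<tau>, x, v, u))"
proof (rule Bochner_Integration.integrable_bound)
  show "integrable lborel (\<lambda>u. 48 * pi * R * (R + R\<^sup>2) * (1 + norm v) * ((1 + norm u) * exp (- \<beta> * (norm (u::vec3))\<^sup>2)))"
    by (intro integrable_mult_right integrable_gaussian_moment \<beta>)
  show "AE u in lborel. norm (sphere_average h (\<tau>, x, v, u))
    \<le> norm (48 * pi * R * (R + R\<^sup>2) * (1 + norm v) * ((1 + norm u) * exp (- \<beta> * (norm (u::vec3))\<^sup>2)))"
    using order_trans[OF sphere_average_bound[OF assms] abs_ge_self] by simp
qed (rule sphere_average_measurable[OF assms])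

lemma continuous_on_signed_source:
  assumes h: "gauss_bounded \<beta> R h"
  shows "continuous_on UNIV (\<lambda>(\<tau>, x, v). signed_source h \<tau> x v)"
proof -
  have "continuous_on UNIV (\<lambda>p. LINT u|lborel. sphere_average h (fst p, fst (snd p), snd (snd p), u))"
  proof (rule continuous_on_lebesgue_integral[where g = "\<lambda>u. (1 + norm u) * exp (- \<beta> * (norm u)\<^sup>2)" and
        c = "\<lambda>p. 48 * pi * R * (R + R\<^sup>2) * (1 + norm (snd (snd p)))"], goal_cases)
    case 2
    show ?case
    proof (rule AE_I2)
      fix p :: "real \<times> vec3 \<times> vec3" and u
      have "continuous_on UNIV (\<lambda>p::real \<times> vec3 \<times> vec3. sphere_average h (fst p, fst (snd p), snd (snd p), u))"
        by (intro continuous_on_sphere_average'[OF h] continuous_intros)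
      then show "isCont (\<lambda>p. sphere_average h (fst p, fst (snd p), snd (snd p), u)) p"
        unfolding continuous_on_eq_continuous_at[OF open_UNIV] by blast
    qed
  next
    case 3
    show ?case by (intro continuous_intros)
  next
    case 5
    show ?case by simp
  qed (rule sphere_average_bound[OF h] sphere_average_measurable[OF h] integrable_gaussian_moment[OF \<beta>])+
  then show ?thesis
    by (simp add: signed_source_eq case_prod_beta)
qed

text \<open>A crude bound without decay, uniform in time and position; it serves only as a majorant
  when continuity of the time integral is shown.\<close>

lemma signed_source_bound:
  assumes h: "gauss_bounded \<beta> R h"
  obtains K where "0 \<le> K" "\<And>\<tau> x v. \<bar>signed_source h \<tau> x v\<bar> \<le> K * (1 + norm v)"
proof
  let ?I = "LINT u|lborel. (1 + norm u) * exp (- \<beta> * (norm (u::vec3))\<^sup>2)"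
  have R: "0 \<le> R" using h by (rule gauss_bounded_nonneg)
  then show "0 \<le> 48 * pi * R * (R + R\<^sup>2) * ?I"
    by simp
  fix \<tau> x v
  have "\<bar>signed_source h \<tau> x v\<bar> \<le> (LINT u|lborel. \<bar>sphere_average h (\<tau>, x, v, u)\<bar>)"
    unfolding signed_source_eq by (rule integral_abs_bound)
  also have "\<dots> \<le> (LINT u|lborel. 48 * pi * R * (R + R\<^sup>2) * (1 + norm v) * ((1 + norm (u::vec3)) * exp (- \<beta> * (norm u)\<^sup>2)))"
    by (intro integral_mono integrable_abs sphere_average_integrable[OF h] integrable_mult_right
        integrable_gaussian_moment \<beta> sphere_average_bound[OF h])
  also have "\<dots> = 48 * pi * R * (R + R\<^sup>2) * ?I * (1 + norm v)"
    unfolding integral_mult_right_zero by (simp only: mult_ac)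
  finally show "\<bar>signed_source h \<tau> x v\<bar> \<le> 48 * pi * R * (R + R\<^sup>2) * ?I * (1 + norm v)" .
qed

text \<open>The weight at u' = v, v' = u type pairs reduces to that of u and v, so the Gaussian in x
  and v comes out of the integral and 4 pi times 12 gives 48 pi. The u-integral is left unevaluated:
  its factor |v - u| is cancelled only by integrating in time first.\<close>

lemma signed_source_diff_bound:
  assumes h: "gauss_bounded \<beta> R h1" "gauss_bounded \<beta> R h2"
    and d: "\<And>t x v. \<bar>h1 t x v - h2 t x v\<bar> \<le> D * exp (- \<beta> * ((norm x)\<^sup>2 + (norm v)\<^sup>2))"
  shows "ennreal \<bar>signed_source h1 \<tau> x v - signed_source h2 \<tau> x v\<bar>
    \<le> ennreal (48 * pi * D * (R + R\<^sup>2) * exp (- \<beta> * ((norm x)\<^sup>2 + (norm v)\<^sup>2))) *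
      (\<integral>\<^sup>+u. ennreal (norm (v - u) *
        exp (- \<beta> * ((norm (x + \<tau> *\<^sub>R (v - u)))\<^sup>2 + (norm u)\<^sup>2))) \<partial>lborel)"
proof -
  let ?A = "\<lambda>h u. sphere_average h (\<tau>, x, v, u)"
  let ?C = "48 * pi * D * (R + R\<^sup>2) * exp (- \<beta> * ((norm x)\<^sup>2 + (norm v)\<^sup>2))"
  have D: "0 \<le> D" using d[of 0 0 0] by simp
  have R: "0 \<le> R" using h(1) by (rule gauss_bounded_nonneg)
  have C: "0 \<le> ?C" using D R by simp
  have A: "\<bar>?A h1 u - ?A h2 u\<bar> \<le> ?C * (norm (v - u) * maxwellian \<beta> \<tau> x v u)" for u
  proof -
    have "?A h1 u - ?A h2 u = (LINT \<omega>|sphere_measure.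
        signed_kernel (slice h1 \<tau> x v) v u \<omega> - signed_kernel (slice h2 \<tau> x v) v u \<omega>)"
      using signed_kernel_sphere_integrable h by (simp add: sphere_average_def)
    also have "\<bar>\<dots>\<bar> \<le> 4 * pi * (12 * D * (R + R\<^sup>2) * (norm (v - u) * (maxwellian \<beta> \<tau> x v u * maxwellian \<beta> \<tau> x v v)))"
      using signed_kernel_sphere_integrable h
      by (intro abs_integral_sphere_le signed_kernel_slice_lipschitz h d) auto
    also have "\<dots> = ?C * (norm (v - u) * maxwellian \<beta> \<tau> x v u)"
      by (simp add: maxwellian_diag mult_ac)
    finally show ?thesis .
  qed
  have int: "integrable lborel (\<lambda>u. ?A h1 u - ?A h2 u)"
    using sphere_average_integrable h by simp
  have "ennreal \<bar>signed_source h1 \<tau> x v - signed_source h2 \<tau> x v\<bar> = ennreal (norm (LINT u|lborel. ?A h1 u - ?A h2 u))"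
    using sphere_average_integrable h by (simp add: signed_source_eq)
  also have "\<dots> \<le> (\<integral>\<^sup>+u. ennreal (norm (?A h1 u - ?A h2 u)) \<partial>lborel)"
    by (rule integral_norm_bound_ennreal[OF int])
  also have "\<dots> \<le> (\<integral>\<^sup>+u. ennreal (?C * (norm (v - u) * maxwellian \<beta> \<tau> x v u)) \<partial>lborel)"
    using A by (intro nn_integral_mono ennreal_leI) simp
  also have "\<dots> = (\<integral>\<^sup>+u. ennreal ?C * ennreal (norm (v - u) * maxwellian \<beta> \<tau> x v u) \<partial>lborel)"
    by (intro nn_integral_cong ennreal_mult C mult_nonneg_nonneg less_imp_le[OF maxwellian_pos]) simp
  also have "\<dots> = ennreal ?C * (\<integral>\<^sup>+u. ennreal (norm (v - u) * maxwellian \<beta> \<tau> x v u) \<partial>lborel)"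
    unfolding maxwellian_def by (intro nn_integral_cmult) measurable
  finally show ?thesis by (simp add: maxwellian_def)
qed

end

lemma signed_source_zero: "signed_source (\<lambda>_ _ _. 0) \<tau> x v = 0"
  by (simp add: signed_source_def signed_kernel_def slice_def)

subsection \<open>The Picard map\<close>

text \<open>Clamping time at \<open>0\<close> makes continuity and bounds hold for all real times.\<close>
definition picard :: "(vec3 \<Rightarrow> vec3 \<Rightarrow> real) \<Rightarrow> density \<Rightarrow> density" where
  "picard F0 h t x v = F0 x v + (LINT \<tau>:{0..max t 0}|lborel. signed_source h \<tau> x v)"

context
  fixes \<beta> R :: real
  assumes \<beta>: "0 < \<beta>"
begin

lemma signed_source_set_integrable:
  assumes "gauss_bounded \<beta> R h"
  shows "set_integrable lborel {a..b} (\<lambda>\<tau>. signed_source h \<tau> x v)"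
  by (intro borel_integrable_atLeastAtMost' continuous_on_density[OF continuous_on_signed_source[OF \<beta> assms]]
      continuous_intros)

text \<open>Extending the time integral to the whole line makes the bound independent of t and
  brings in the factor pi^2/\<beta>^2 of \<open>nn_integral_collision_frequency\<close>.\<close>

lemma signed_source_integral_diff:
  assumes h: "gauss_bounded \<beta> R h1" "gauss_bounded \<beta> R h2"
    and d: "\<And>t x v. \<bar>h1 t x v - h2 t x v\<bar> \<le> D * exp (- \<beta> * ((norm x)\<^sup>2 + (norm v)\<^sup>2))"
  shows "\<bar>(LINT \<tau>:{0..t}|lborel. signed_source h1 \<tau> x v) - (LINT \<tau>:{0..t}|lborel. signed_source h2 \<tau> x v)\<bar>
    \<le> 48 * pi ^ 3 * D * ((R + R\<^sup>2) / \<beta>\<^sup>2) * exp (- \<beta> * ((norm x)\<^sup>2 + (norm v)\<^sup>2))"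
proof -
  let ?E = "exp (- \<beta> * ((norm x)\<^sup>2 + (norm v)\<^sup>2))"
  let ?d = "\<lambda>\<tau>. signed_source h1 \<tau> x v - signed_source h2 \<tau> x v"
  let ?N = "\<lambda>\<tau>. \<integral>\<^sup>+u. ennreal (norm (v - u) *
        exp (- \<beta> * ((norm (x + \<tau> *\<^sub>R (v - u)))\<^sup>2 + (norm u)\<^sup>2))) \<partial>lborel"
  have D: "0 \<le> D" using d[of 0 0 0] by simp
  have R: "0 \<le> R" using h(1) by (rule gauss_bounded_nonneg)
  have C: "0 \<le> 48 * pi * D * (R + R\<^sup>2) * ?E" using D R by simp
  have int: "set_integrable lborel {0..t} ?d"
    using signed_source_set_integrable h by (intro set_integral_diff) auto
  have "(LINT \<tau>:{0..t}|lborel. signed_source h1 \<tau> x v) - (LINT \<tau>:{0..t}|lborel. signed_source h2 \<tau> x v)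
      = (LINT \<tau>:{0..t}|lborel. ?d \<tau>)"
    using signed_source_set_integrable h by (intro set_integral_diff(2)[symmetric]) auto
  then have "ennreal \<bar>(LINT \<tau>:{0..t}|lborel. signed_source h1 \<tau> x v) - (LINT \<tau>:{0..t}|lborel. signed_source h2 \<tau> x v)\<bar>
      = ennreal (norm (LINT \<tau>|lborel. indicat_real {0..t} \<tau> *\<^sub>R ?d \<tau>))"
    by (simp add: set_lebesgue_integral_def)
  also have "\<dots> \<le> (\<integral>\<^sup>+\<tau>. ennreal (norm (indicat_real {0..t} \<tau> *\<^sub>R ?d \<tau>)) \<partial>lborel)"
    by (rule integral_norm_bound_ennreal[OF int[unfolded set_integrable_def]])
  also have "\<dots> \<le> (\<integral>\<^sup>+\<tau>. ennreal \<bar>?d \<tau>\<bar> \<partial>lborel)"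
    by (intro nn_integral_mono ennreal_leI) (simp add: indicator_def)
  also have "\<dots> \<le> (\<integral>\<^sup>+\<tau>. ennreal (48 * pi * D * (R + R\<^sup>2) * ?E) * ?N \<tau> \<partial>lborel)"
    by (intro nn_integral_mono signed_source_diff_bound \<beta> h d)
  also have "\<dots> = ennreal (48 * pi * D * (R + R\<^sup>2) * ?E) * (\<integral>\<^sup>+\<tau>. ?N \<tau> \<partial>lborel)"
    by (intro nn_integral_cmult) measurable
  also have "\<dots> \<le> ennreal (48 * pi * D * (R + R\<^sup>2) * ?E) * ennreal (pi\<^sup>2 / \<beta>\<^sup>2)"
    by (intro mult_left_mono nn_integral_collision_frequency \<beta>) simp
  also have "\<dots> = ennreal (48 * pi * D * (R + R\<^sup>2) * ?E * (pi\<^sup>2 / \<beta>\<^sup>2))"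
    using C by (intro ennreal_mult[symmetric]) auto
  finally have "\<bar>(LINT \<tau>:{0..t}|lborel. signed_source h1 \<tau> x v) - (LINT \<tau>:{0..t}|lborel. signed_source h2 \<tau> x v)\<bar>
      \<le> 48 * pi * D * (R + R\<^sup>2) * ?E * (pi\<^sup>2 / \<beta>\<^sup>2)"
    using C by (subst (asm) ennreal_le_iff) auto
  also have "\<dots> = 48 * pi ^ 3 * D * ((R + R\<^sup>2) / \<beta>\<^sup>2) * ?E"
    by (simp add: power3_eq_cube power2_eq_square)
  finally show ?thesis .
qed

lemma signed_source_integral_bound:
  assumes h: "gauss_bounded \<beta> R h"
  shows "\<bar>LINT \<tau>:{0..t}|lborel. signed_source h \<tau> x v\<bar>
    \<le> 48 * pi ^ 3 * R * ((R + R\<^sup>2) / \<beta>\<^sup>2) * exp (- \<beta> * ((norm x)\<^sup>2 + (norm v)\<^sup>2))"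
proof -
  have "gauss_bounded \<beta> R (\<lambda>_ _ _. 0)"
    using gauss_bounded_nonneg[OF h] by (simp add: gauss_bounded_def case_prod_beta)
  from signed_source_integral_diff[OF h this, of R t x v] gauss_boundedD(1)[OF h]
  show ?thesis by (simp add: signed_source_zero)
qed

text \<open>The moving interval is written as an indicator inside an integral over the whole line,
  to which dominated convergence applies.\<close>

lemma continuous_on_signed_source_integral:
  assumes h: "gauss_bounded \<beta> R h"
  shows "continuous_on UNIV (\<lambda>(t, x, v). LINT \<tau>:{0..max t 0}|lborel. signed_source h \<tau> x v)"
proof -
  obtain K where K: "0 \<le> K" "\<And>\<tau> x v. \<bar>signed_source h \<tau> x v\<bar> \<le> K * (1 + norm v)"
    using signed_source_bound[OF \<beta> h] by metis
  let ?f = "\<lambda>(p::real \<times> vec3 \<times> vec3) \<tau>. indicat_real {0..max (fst p) 0} \<tau> * signed_source h \<tau> (fst (snd p)) (snd (snd p))"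
  note src = continuous_on_density[OF continuous_on_signed_source[OF \<beta> h]]
  have "continuous_on UNIV (\<lambda>p. LINT \<tau>|lborel. ?f p \<tau>)"
  \<comment> \<open>On the interval \<tau>^2 \<le> t^2, so exp(t^2) exp(-\<tau>^2) \<ge> 1 there: a
    Gaussian in \<tau> serves as majorant for all t at once.\<close>
  proof (rule continuous_on_lebesgue_integral[where g = "\<lambda>\<tau>. exp (- 1 * (\<tau> - 0)\<^sup>2)" and
        c = "\<lambda>p. exp ((fst p)\<^sup>2) * (K * (1 + norm (snd (snd p))))"], goal_cases)
    case (1 p)
    have "(\<lambda>\<tau>. signed_source h \<tau> (fst (snd p)) (snd (snd p))) \<in> borel_measurable borel"
      by (intro borel_measurable_continuous_onI src continuous_intros)
    then show ?case by simp
  next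
    case (2 p)
    \<comment> \<open>Away from the endpoint, a null set, the indicator is constant for parameters
      near p, and only the continuous factor varies.\<close>
    have "AE \<tau> in lborel. \<tau> \<noteq> max (fst p) 0" by (rule AE_lborel_singleton)
    then show ?case
    proof eventually_elim
      case (elim \<tau>)
      have "((\<lambda>q. max (fst q) 0) \<longlongrightarrow> max (fst p) 0) (nhds p)"
        by (intro tendsto_intros filterlim_ident)
      then have "\<forall>\<^sub>F q in nhds p. indicat_real {0..max (fst q) 0} \<tau> = indicat_real {0..max (fst p) 0} \<tau>"
      proof (cases "\<tau> < max (fst p) 0")
        case True
        with \<open>((\<lambda>q. max (fst q) 0) \<longlongrightarrow> max (fst p) 0) (nhds p)\<close> have "\<forall>\<^sub>F q in nhds p. \<tau> < max (fst q) 0"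
          by (rule order_tendstoD(1))
        then show ?thesis
          by eventually_elim (use True in \<open>simp add: indicator_def\<close>)
      next
        case False
        with elim have "max (fst p) 0 < \<tau>"
          by (metis linorder_neqE_linordered_idom)
        with \<open>((\<lambda>q. max (fst q) 0) \<longlongrightarrow> max (fst p) 0) (nhds p)\<close> have "\<forall>\<^sub>F q in nhds p. max (fst q) 0 < \<tau>"
          by (rule order_tendstoD(2))
        then show ?thesis
          by eventually_elim (use \<open>max (fst p) 0 < \<tau>\<close> in \<open>simp add: indicator_def flip: not_less\<close>)
      qed
      then have ev: "\<forall>\<^sub>F q in nhds p. ?f q \<tau> = indicat_real {0..max (fst p) 0} \<tau> * signed_source h \<tau> (fst (snd q)) (snd (snd q))"
        by eventually_elim simp
      have "continuous_on UNIV (\<lambda>q::real \<times> vec3 \<times> vec3. indicat_real {0..max (fst p) 0} \<tau> * signed_source h \<tau> (fst (snd q)) (snd (snd q)))"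
        by (intro continuous_intros src)
      then show ?case
        unfolding isCont_cong[OF ev] continuous_on_eq_continuous_at[OF open_UNIV] by blast
    qed
  next
    case 3
    show ?case by (intro continuous_intros)
  next
    case 4
    show ?case
      using nn_integral_gaussian_real[of 1 0] by (intro integrableI_bounded) auto
  next
    case (6 p \<tau>)
    show ?case
    proof (cases "0 \<le> \<tau> \<and> \<tau> \<le> fst p")
      case True
      then have "\<tau>\<^sup>2 \<le> (fst p)\<^sup>2"
        by (intro power_mono) auto
      then have "1 \<le> exp ((fst p)\<^sup>2) * exp (- (\<tau>\<^sup>2))"
        by (simp flip: exp_add)
      then have "K * (1 + norm (snd (snd p))) * 1 \<le> K * (1 + norm (snd (snd p))) * (exp ((fst p)\<^sup>2) * exp (- (\<tau>\<^sup>2)))"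
        using K(1) by (intro mult_left_mono) auto
      then show ?thesis
        using True K(2)[of \<tau> "fst (snd p)" "snd (snd p)"] by (simp add: mult_ac)
    next
      case False
      show ?thesis
      \<comment> \<open>For negative t the clamped interval is still the point 0, which the previous
        case misses.\<close>
      proof (cases "\<tau> = 0")
        case True
        have "K * (1 + norm (snd (snd p))) * 1 \<le> K * (1 + norm (snd (snd p))) * exp ((fst p)\<^sup>2)"
          using K(1) by (intro mult_left_mono) auto
        then show ?thesis
          using True K(2)[of \<tau> "fst (snd p)" "snd (snd p)"] by (simp add: mult_ac)
      next
        case f: False
        then have "\<not> (0 \<le> \<tau> \<and> \<tau> \<le> max (fst p) 0)"
          using False by auto
        then show ?thesis using K(1) by (auto simp: indicator_def)
      qed
    qed
  qed simp
  then show ?thesis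
    by (simp add: set_lebesgue_integral_def case_prod_beta)
qed

text \<open>The data take up R/2 and the collision integral the other R/2; hence the 96 = 2 * 48 in
  the smallness condition, which also yields the contraction factor 1/2.\<close>

lemma picard_gauss_bounded:
  assumes h: "gauss_bounded \<beta> R h"
    and F0: "continuous_on UNIV (\<lambda>(x, v). F0 x v)"
      "\<And>x v. \<bar>F0 x v\<bar> \<le> R / 2 * exp (- \<beta> * ((norm x)\<^sup>2 + (norm v)\<^sup>2))"
    and small: "96 * pi ^ 3 * ((R + R\<^sup>2) / \<beta>\<^sup>2) \<le> 1"
  shows "gauss_bounded \<beta> R (picard F0 h)"
  unfolding gauss_bounded_def
proof (intro conjI allI)
  have "continuous_on UNIV (\<lambda>(t::real, x, v). F0 x v)"
    using continuous_on_compose2[OF F0(1), of UNIV "snd :: real \<times> vec3 \<times> vec3 \<Rightarrow> _"]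
    by (simp add: case_prod_beta continuous_on_snd)
  from continuous_on_add[OF this continuous_on_signed_source_integral[OF h]]
  show "continuous_on UNIV (\<lambda>(t, x, v). picard F0 h t x v)"
    by (simp add: picard_def case_prod_beta)
  fix t and x v :: vec3
  let ?E = "exp (- \<beta> * ((norm x)\<^sup>2 + (norm v)\<^sup>2))"
  have "48 * pi ^ 3 * R * ((R + R\<^sup>2) / \<beta>\<^sup>2) * ?E = R * ?E / 2 * (96 * pi ^ 3 * ((R + R\<^sup>2) / \<beta>\<^sup>2))"
    by simp
  also have "\<dots> \<le> R * ?E / 2"
    using small gauss_bounded_nonneg[OF h] by (intro mult_left_le) auto
  finally have "\<bar>LINT \<tau>:{0..max t 0}|lborel. signed_source h \<tau> x v\<bar> \<le> R * ?E / 2"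
    using signed_source_integral_bound[OF h, of "max t 0" x v] by linarith
  then show "\<bar>picard F0 h t x v\<bar> \<le> R * ?E"
    using F0(2)[of x v] by (simp add: picard_def)
qed

lemma picard_contraction:
  assumes h: "gauss_bounded \<beta> R h1" "gauss_bounded \<beta> R h2"
    and d: "\<And>t x v. \<bar>h1 t x v - h2 t x v\<bar> \<le> D * exp (- \<beta> * ((norm x)\<^sup>2 + (norm v)\<^sup>2))"
    and small: "96 * pi ^ 3 * ((R + R\<^sup>2) / \<beta>\<^sup>2) \<le> 1"
  shows "\<bar>picard F0 h1 t x v - picard F0 h2 t x v\<bar> \<le> D / 2 * exp (- \<beta> * ((norm x)\<^sup>2 + (norm v)\<^sup>2))"
proof -
  let ?E = "exp (- \<beta> * ((norm x)\<^sup>2 + (norm v)\<^sup>2))"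
  have "48 * pi ^ 3 * D * ((R + R\<^sup>2) / \<beta>\<^sup>2) * ?E = D / 2 * ?E * (96 * pi ^ 3 * ((R + R\<^sup>2) / \<beta>\<^sup>2))"
    by simp
  also have "\<dots> \<le> D / 2 * ?E"
    using small d[of 0 0 0] by (intro mult_left_le) auto
  finally show ?thesis
    using signed_source_integral_diff[OF h d, of "max t 0" x v] by (simp add: picard_def)
qed

text \<open>Division by the Gaussian identifies these densities with the closed R-ball of the
  complete space of bounded continuous functions, where Banach's theorem applies.\<close>

lemma picard_fixed_point:
  assumes R: "0 \<le> R"
    and F0: "continuous_on UNIV (\<lambda>(x, v). F0 x v)"
      "\<And>x v. \<bar>F0 x v\<bar> \<le> R / 2 * exp (- \<beta> * ((norm x)\<^sup>2 + (norm v)\<^sup>2))"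
    and small: "96 * pi ^ 3 * ((R + R\<^sup>2) / \<beta>\<^sup>2) \<le> 1"
  shows "\<exists>!h. gauss_bounded \<beta> R h \<and> picard F0 h = h"
proof -
  define E :: "vec3 \<Rightarrow> vec3 \<Rightarrow> real" where "E x v = exp (- \<beta> * ((norm x)\<^sup>2 + (norm v)\<^sup>2))" for x v
  have E: "0 < E x v" for x v by (simp add: E_def)
  define dens :: "((real \<times> vec3 \<times> vec3) \<Rightarrow>\<^sub>C real) \<Rightarrow> density" where
    "dens \<phi> t x v = apply_bcontfun \<phi> (t, x, v) * E x v" for \<phi> t x v
  \<comment> \<open>\<open>Bcontfun\<close> is meaningful only on bounded continuous arguments, so
    facts on \<open>code\<close> are proved under \<open>gauss_bounded\<close>.\<close>
  define code :: "density \<Rightarrow> ((real \<times> vec3 \<times> vec3) \<Rightarrow>\<^sub>C real)" where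
    "code h = Bcontfun (\<lambda>(t, x, v). h t x v / E x v)" for h
  have code: "apply_bcontfun (code h) = (\<lambda>(t, x, v). h t x v / E x v)" "norm (code h) \<le> R" "dens (code h) = h"
    if h: "gauss_bounded \<beta> R h" for h
  proof -
    have le: "norm ((\<lambda>(t, x, v). h t x v / E x v) p) \<le> R" for p
      using gauss_boundedD(1)[OF h, of "fst p" "fst (snd p)" "snd (snd p)"] E[of "fst (snd p)" "snd (snd p)"]
      by (simp add: case_prod_beta abs_divide pos_divide_le_eq E_def)
    have "continuous_on UNIV (\<lambda>p. h (fst p) (fst (snd p)) (snd (snd p)) / E (fst (snd p)) (snd (snd p)))"
      using h unfolding gauss_bounded_def E_def
      by (intro continuous_intros continuous_on_density[of h]) auto
    then show 1: "apply_bcontfun (code h) = (\<lambda>(t, x, v). h t x v / E x v)"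
      unfolding code_def using le
      by (intro Bcontfun_inverse bcontfun_normI[where b = R]) (auto simp: case_prod_beta)
    show "norm (code h) \<le> R"
      using le by (intro norm_bound) (simp add: 1)
    show "dens (code h) = h"
    proof (intro ext)
      show "dens (code h) t x v = h t x v" for t x v
        using E[of x v] by (simp add: dens_def 1)
    qed
  qed
  have dens: "gauss_bounded \<beta> R (dens \<phi>)" if "norm \<phi> \<le> R" for \<phi>
    unfolding gauss_bounded_def
  proof (intro conjI allI)
    show "continuous_on UNIV (\<lambda>(t, x, v). dens \<phi> t x v)"
      unfolding dens_def E_def case_prod_beta
      by (intro continuous_intros continuous_on_compose2[OF continuous_on_apply_bcontfun[of UNIV \<phi>]]) auto
    fix t x v
    have "\<bar>apply_bcontfun \<phi> (t, x, v)\<bar> \<le> R"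
      using norm_bounded[of \<phi> "(t, x, v)"] that by simp
    then show "\<bar>dens \<phi> t x v\<bar> \<le> R * exp (- \<beta> * ((norm x)\<^sup>2 + (norm v)\<^sup>2))"
      by (simp add: dens_def abs_mult E_def)
  qed
  define \<Phi> where "\<Phi> \<phi> = code (picard F0 (dens \<phi>))" for \<phi>
  have pic: "gauss_bounded \<beta> R (picard F0 (dens \<phi>))" if "norm \<phi> \<le> R" for \<phi>
    by (rule picard_gauss_bounded[OF dens[OF that] F0 small])
  have "\<exists>!\<phi>. \<phi> \<in> cball 0 R \<and> \<Phi> \<phi> = \<phi>"
  proof (rule Banach_fix[where c = "1/2"])
    show "complete (cball 0 R :: ((real \<times> vec3 \<times> vec3) \<Rightarrow>\<^sub>C real) set)"
      by (simp add: complete_eq_closed)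
    show "cball 0 R \<noteq> ({} :: ((real \<times> vec3 \<times> vec3) \<Rightarrow>\<^sub>C real) set)"
      using R by simp
    show "\<Phi> ` cball 0 R \<subseteq> cball 0 R"
    proof (rule image_subsetI)
      fix \<phi> assume "\<phi> \<in> cball (0 :: (real \<times> vec3 \<times> vec3) \<Rightarrow>\<^sub>C real) R"
      then have "norm (code (picard F0 (dens \<phi>))) \<le> R"
        by (intro code(2) pic) simp
      then show "\<Phi> \<phi> \<in> cball 0 R"
        by (simp add: \<Phi>_def)
    qed
    fix \<phi> \<psi> :: "(real \<times> vec3 \<times> vec3) \<Rightarrow>\<^sub>C real"
    assume "\<phi> \<in> cball 0 R" "\<psi> \<in> cball 0 R"
    then have n: "norm \<phi> \<le> R" "norm \<psi> \<le> R" by auto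
    show "dist (\<Phi> \<phi>) (\<Phi> \<psi>) \<le> 1/2 * dist \<phi> \<psi>"
    proof (rule dist_bound)
      fix p :: "real \<times> vec3 \<times> vec3"
      obtain t x v where p: "p = (t, x, v)" by (cases p)
      have "\<bar>dens \<phi> t x v - dens \<psi> t x v\<bar> \<le> dist \<phi> \<psi> * exp (- \<beta> * ((norm x)\<^sup>2 + (norm v)\<^sup>2))" for t x v
      proof -
        have "\<bar>dens \<phi> t x v - dens \<psi> t x v\<bar> = dist (apply_bcontfun \<phi> (t, x, v)) (apply_bcontfun \<psi> (t, x, v)) * E x v"
          using E[of x v] by (simp add: dens_def dist_real_def abs_mult flip: left_diff_distrib)
        also have "\<dots> \<le> dist \<phi> \<psi> * E x v"
          using E[of x v] by (intro mult_right_mono dist_bounded) auto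
        finally show ?thesis by (simp add: E_def)
      qed
      from picard_contraction[OF dens[OF n(1)] dens[OF n(2)] this small, of F0 t x v]
      have "\<bar>picard F0 (dens \<phi>) t x v - picard F0 (dens \<psi>) t x v\<bar> \<le> dist \<phi> \<psi> / 2 * E x v"
        by (simp add: E_def)
      then have "\<bar>picard F0 (dens \<phi>) t x v - picard F0 (dens \<psi>) t x v\<bar> / E x v \<le> dist \<phi> \<psi> / 2"
        using E[of x v] by (simp only: pos_divide_le_eq)
      moreover have "dist (apply_bcontfun (\<Phi> \<phi>) p) (apply_bcontfun (\<Phi> \<psi>) p)
          = \<bar>picard F0 (dens \<phi>) t x v - picard F0 (dens \<psi>) t x v\<bar> / E x v"
        using E[of x v]
        unfolding \<Phi>_def code(1)[OF pic[OF n(1)]] code(1)[OF pic[OF n(2)]] p prod.case dist_real_def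
          diff_divide_distrib[symmetric] abs_divide
        by simp
      ultimately show "dist (apply_bcontfun (\<Phi> \<phi>) p) (apply_bcontfun (\<Phi> \<psi>) p) \<le> 1/2 * dist \<phi> \<psi>"
        by simp
    qed
  qed auto
  then obtain \<phi> where "\<phi> \<in> cball 0 R \<and> \<Phi> \<phi> = \<phi>"
    and unique: "\<forall>\<psi>. \<psi> \<in> cball 0 R \<and> \<Phi> \<psi> = \<psi> \<longrightarrow> \<psi> = \<phi>"
    by (rule ex1E)
  then have \<phi>: "norm \<phi> \<le> R" "\<Phi> \<phi> = \<phi>"
    using mem_cball_0[of \<phi> R] by blast+
  show ?thesis
  \<comment> \<open>Since \<open>dens (code h) = h\<close>, fixed points correspond on both sides
    and uniqueness carries over.\<close>
  proof (rule ex1I[of _ "dens \<phi>"])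
    show "gauss_bounded \<beta> R (dens \<phi>) \<and> picard F0 (dens \<phi>) = dens \<phi>"
      using dens[OF \<phi>(1)] code(3)[OF pic[OF \<phi>(1)]] \<phi>(2) unfolding \<Phi>_def by metis
    fix h assume h: "gauss_bounded \<beta> R h \<and> picard F0 h = h"
    then have "\<Phi> (code h) = code h" "norm (code h) \<le> R"
      using code(2,3)[of h] unfolding \<Phi>_def by metis+
    then have "code h = \<phi>"
      using unique mem_cball_0[of "code h" R] by blast
    then show "h = dens \<phi>"
      using h code(3)[of h] by metis
  qed
qed

text \<open>
  After the last time at which the solution is nonnegative on a characteristic, the signed
  source is nonnegative there, so the solution cannot have become negative.
\<close>
lemma picard_fixed_point_nonneg:
  assumes h: "gauss_bounded \<beta> R h" and fp: "picard F0 h = h"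
    and F0: "\<And>x v. 0 \<le> F0 x v" and t: "0 \<le> t"
  shows "0 \<le> h t x v"
proof (rule ccontr)
  assume neg: "\<not> 0 \<le> h t x v"
  have eq: "h s x v = F0 x v + (LINT \<tau>:{0..s}|lborel. signed_source h \<tau> x v)" if "0 \<le> s" for s
    using that fun_cong[OF fun_cong[OF fun_cong[OF fp, of s], of x], of v] by (simp add: picard_def)
  \<comment> \<open>A is compact and contains 0, as the initial datum is nonnegative; its maximum s
    is the last nonnegative time before t.\<close>
  define A where "A = {s \<in> {0..t}. 0 \<le> h s x v}"
  have "continuous_on {0..t} (\<lambda>s. h s x v)"
    using h by (intro continuous_on_density[of h] continuous_intros) (auto simp: gauss_bounded_def)
  then have "closed A"
    unfolding A_def by (intro continuous_closed_preimage_constant continuous_on_closed_Collect_le) auto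
  moreover have "A \<subseteq> {0..t}"
    by (auto simp: A_def)
  ultimately have "compact A"
    by (metis compact_eq_bounded_closed bounded_closed_interval bounded_subset)
  moreover have "0 \<in> A"
  proof -
    have "AE \<tau> in lborel. indicat_real {0..0} \<tau> *\<^sub>R signed_source h \<tau> x v = 0"
      using AE_lborel_singleton[of "0::real"] by eventually_elim simp
    then have "(LINT \<tau>:{0..0}|lborel. signed_source h \<tau> x v) = 0"
      unfolding set_lebesgue_integral_def by (rule integral_eq_zero_AE)
    then show ?thesis
      using eq[of 0] F0[of x v] t by (simp add: A_def)
  qed
  ultimately obtain s where s: "s \<in> A" "\<And>r. r \<in> A \<Longrightarrow> r \<le> s"
    using compact_attains_sup[of A] by auto
  then have st: "0 \<le> s" "s \<le> t" "0 \<le> h s x v"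
    by (auto simp: A_def)
  have "0 \<le> signed_source h \<tau> x v" if "\<tau> \<in> {s<..t}" for \<tau>
  proof -
    have "\<tau> \<notin> A" using s(2)[of \<tau>] that by auto
    \<comment> \<open>At w = v the spatial shift vanishes, so this slice value is
      \<open>h \<tau> x v\<close>.\<close>
    then have "slice h \<tau> x v v \<le> 0"
      using that st by (auto simp: A_def slice_def)
    then show ?thesis
      unfolding signed_source_def
      by (intro Bochner_Integration.integral_nonneg signed_kernel_nonneg)
  qed
  then have "0 \<le> (LINT \<tau>:{s<..t}|lborel. signed_source h \<tau> x v)"
    unfolding set_lebesgue_integral_def
    by (intro Bochner_Integration.integral_nonneg) (simp add: indicator_def)
  moreover have "(LINT \<tau>:{0..t}|lborel. signed_source h \<tau> x v)
      = (LINT \<tau>:{0..s}|lborel. signed_source h \<tau> x v) + (LINT \<tau>:{s<..t}|lborel. signed_source h \<tau> x v)"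
  proof -
    have "{0..t} = {0..s} \<union> {s<..t}" using st by auto
    moreover have "set_integrable lborel {s<..t} (\<lambda>\<tau>. signed_source h \<tau> x v)"
      by (rule set_integrable_subset[OF signed_source_set_integrable[OF h, of s t]]) auto
    ultimately show ?thesis
      using signed_source_set_integrable[OF h, of 0 s] by (simp add: set_integral_Un disjoint_iff)
  qed
  ultimately have "h s x v \<le> h t x v"
    using eq[of s] eq[of t] st t by simp
  then show False
    using st neg by simp
qed

end

subsection \<open>Mild solutions\<close>

text \<open>Membership in \<open>gauss_space\<close> bounds the set under the supremum; only then
  does the value of the supremum control each point.\<close>

lemma gauss_ball_iff:
  assumes F: "F \<in> gauss_space \<beta>"
  shows "F \<in> gauss_ball \<beta> R \<longleftrightarrow> (\<forall>t\<ge>0. \<forall>x v. \<bar>F t x v\<bar> \<le> R * exp (- \<beta> * ((norm x)\<^sup>2 + (norm v)\<^sup>2)))"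
proof -
  let ?g = "\<lambda>(t, x, v). exp (\<beta> * ((norm x)\<^sup>2 + (norm v)\<^sup>2)) * \<bar>F t x v\<bar>"
  let ?S = "{0::real..} \<times> (UNIV :: vec3 set) \<times> (UNIV :: vec3 set)"
  have le_iff: "?g (t, x, v) \<le> c \<longleftrightarrow> \<bar>F t x v\<bar> \<le> c * exp (- \<beta> * ((norm x)\<^sup>2 + (norm v)\<^sup>2))" for t x v c
  proof -
    have "exp (\<beta> * s) * a \<le> c \<longleftrightarrow> a \<le> c * exp (- \<beta> * s)" for s a :: real
      by (simp add: exp_minus field_simps)
    then show ?thesis by (simp only: prod.case)
  qed
  obtain c where c: "\<And>t x v. 0 \<le> t \<Longrightarrow> \<bar>F t x v\<bar> \<le> c * exp (- \<beta> * ((norm x)\<^sup>2 + (norm v)\<^sup>2))"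
    using F by (auto simp: gauss_space_def)
  have "bdd_above (?g ` ?S)"
  proof (rule bdd_aboveI2)
    show "?g p \<le> c" if "p \<in> ?S" for p
      using that c le_iff[of "fst p" "fst (snd p)" "snd (snd p)" c] by (auto simp: case_prod_beta)
  qed
  then have "gauss_norm \<beta> F \<le> R \<longleftrightarrow> (\<forall>p\<in>?S. ?g p \<le> R)"
    unfolding gauss_norm_def by (intro cSUP_le_iff) auto
  also have "\<dots> \<longleftrightarrow> (\<forall>t\<ge>0. \<forall>x v. ?g (t, x, v) \<le> R)"
    by auto
  finally show ?thesis
    unfolding le_iff using F by (simp add: gauss_ball_def)
qed

text \<open>Freezing the density at its time-0 value for negative times extends continuity and the
  bound to the whole line.\<close>

lemma gauss_bounded_clamp:
  assumes "F \<in> gauss_ball \<beta> R"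
  shows "gauss_bounded \<beta> R (\<lambda>t. F (max t 0))"
  unfolding gauss_bounded_def
proof (intro conjI allI)
  have F: "F \<in> gauss_space \<beta>"
    using assms by (simp add: gauss_ball_def)
  then have "continuous_on ({0..} \<times> UNIV \<times> UNIV) (\<lambda>(t, x, v). F t x v)"
    by (simp add: gauss_space_def)
  moreover have "continuous_on UNIV (\<lambda>p::real \<times> vec3 \<times> vec3. (max (fst p) 0, fst (snd p), snd (snd p)))"
    by (intro continuous_intros)
  ultimately have "continuous_on UNIV (\<lambda>p::real \<times> vec3 \<times> vec3.
      case (max (fst p) 0, fst (snd p), snd (snd p)) of (t, x, v) \<Rightarrow> F t x v)"
    by (rule continuous_on_compose2) auto
  then show "continuous_on UNIV (\<lambda>(t, x, v). F (max t 0) x v)"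
    by (simp add: case_prod_beta)
  show "\<bar>F (max t 0) x v\<bar> \<le> R * exp (- \<beta> * ((norm x)\<^sup>2 + (norm v)\<^sup>2))" for t x v
    using assms gauss_ball_iff[OF F] by simp
qed

lemma gauss_bounded_imp_gauss_ball:
  assumes "gauss_bounded \<beta> R h" "0 < R"
  shows "h \<in> gauss_ball \<beta> R"
proof -
  have "h \<in> gauss_space \<beta>"
    using assms continuous_on_subset[of UNIV _ "{0..} \<times> UNIV \<times> UNIV"]
    by (auto simp: gauss_space_def gauss_bounded_def)
  then show ?thesis
    using assms by (simp add: gauss_ball_iff gauss_bounded_def)
qed

lemma density_eq_slice_sharp: "F \<tau> (x + \<tau> *\<^sub>R v) = slice (sharp F) \<tau> x v"
  by (simp add: slice_def sharp_def fun_eq_iff algebra_simps)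

text \<open>For nonnegative \<open>F\<close> all absolute values drop out, which links the modified
  equation to the original one.\<close>

lemma signed_source_sharp:
  assumes "\<And>x v. 0 \<le> F \<tau> x v"
  shows "signed_source (sharp F) \<tau> x v = sharp (Q 1 F) \<tau> x v"
proof -
  let ?f = "slice (sharp F) \<tau> x v"
  have "0 \<le> ?f w" for w
    using assms by (simp flip: density_eq_slice_sharp)
  then have "signed_source (sharp F) \<tau> x v = collision 1 ?f v"
    by (simp add: signed_source_def signed_kernel_def collision_def)
  also have "\<dots> = sharp (Q 1 F) \<tau> x v"
    by (simp add: sharp_def[of "Q 1 F"] Q_def density_eq_slice_sharp[of F])
  finally show ?thesis .
qed

lemma signed_source_clamp:
  assumes "0 \<le> \<tau>"
  shows "signed_source (\<lambda>t. h (max t 0)) \<tau> = signed_source h \<tau>"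
proof -
  have "slice (\<lambda>t. h (max t 0)) \<tau> = slice h \<tau>"
    using assms by (simp add: slice_def fun_eq_iff)
  then show ?thesis
    by (intro ext) (simp only: signed_source_def)
qed

text \<open>One direction gives existence, the other uniqueness. The clamp turns an identity for t
  \<ge> 0 into an equality of functions on all times.\<close>

lemma mild_solution_iff_picard:
  assumes F: "\<And>t x v. 0 \<le> t \<Longrightarrow> 0 \<le> F t x v"
  shows "(\<forall>t\<ge>0. \<forall>x v. sharp F t x v = F0 x v + (LINT \<tau>:{0..t}|lborel. sharp (Q 1 F) \<tau> x v))
    \<longleftrightarrow> picard F0 (\<lambda>t. sharp F (max t 0)) = (\<lambda>t. sharp F (max t 0))"
proof -
  have "picard F0 (\<lambda>t. sharp F (max t 0)) t x v
      = F0 x v + (LINT \<tau>:{0..max t 0}|lborel. sharp (Q 1 F) \<tau> x v)" for t x v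
    unfolding picard_def using F
    by (intro arg_cong2[where f = "(+)"] set_lebesgue_integral_cong)
      (auto simp: signed_source_clamp signed_source_sharp)
  then have "picard F0 (\<lambda>t. sharp F (max t 0)) = (\<lambda>t. sharp F (max t 0)) \<longleftrightarrow>
      (\<forall>t. \<forall>x v. sharp F (max t 0) x v = F0 x v + (LINT \<tau>:{0..max t 0}|lborel. sharp (Q 1 F) \<tau> x v))"
    unfolding fun_eq_iff by metis
  moreover have "(\<forall>t\<ge>0. P t) \<longleftrightarrow> (\<forall>t. P (max t 0))" for P :: "real \<Rightarrow> bool"
    by (metis max.cobounded2 max_absorb1)
  ultimately show ?thesis
    by (rule trans[OF _ sym, rotated])
qed

text \<open>The threshold \<epsilon> is absolute, while \<delta> may depend on \<beta> and R0. The
  first conjunct shows that admissible radii exist; solutions are compared only at meaningful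
  times.\<close>

theorem theorem4p9:
  shows "\<exists>\<epsilon>>0. \<forall>\<beta>>0.
    (\<exists>R0>0. (R0 + R0\<^sup>2) / \<beta>\<^sup>2 \<le> \<epsilon>) \<and>
    (\<forall>R0>0. (R0 + R0\<^sup>2) / \<beta>\<^sup>2 \<le> \<epsilon> \<longrightarrow>
      (\<exists>\<delta>>0. \<forall>F0 :: vec3 \<Rightarrow> vec3 \<Rightarrow> real.
        (\<lambda>_. F0) \<in> gauss_space \<beta> \<and> gauss_norm \<beta> (\<lambda>_. F0) \<le> \<delta> \<and> (\<forall>x v. 0 \<le> F0 x v) \<longrightarrow>
        (\<exists>F. nonneg_mild_solution_in_ball 1 \<beta> R0 F0 F \<and>
             (\<forall>G. nonneg_mild_solution_in_ball 1 \<beta> R0 F0 G \<longrightarrow>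
                  (\<forall>t\<ge>0. \<forall>x v. G t x v = F t x v)))))"
proof (rule exI[of _ "1 / (96 * pi ^ 3)"], intro conjI allI impI)
  show "0 < 1 / (96 * pi ^ 3)"
    by simp
next
  fix \<beta> :: real
  assume \<beta>: "0 < \<beta>"
  \<comment> \<open>R \<le> 1 gives R + R^2 \<le> 2 R, and the second bound makes 2 R at most
    \<beta>^2/(96 pi^3).\<close>
  define R where "R = min 1 (\<beta>\<^sup>2 / (192 * pi ^ 3))"
  have R: "0 < R" "R \<le> 1" "R \<le> \<beta>\<^sup>2 / (192 * pi ^ 3)"
    using \<beta> by (auto simp: R_def)
  have "R + R\<^sup>2 \<le> 2 * R"
    using R(1,2) by (simp add: power2_eq_square mult_left_le)
  also have "\<dots> \<le> 1 / (96 * pi ^ 3) * \<beta>\<^sup>2"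
    using R(3) by simp
  finally have "(R + R\<^sup>2) / \<beta>\<^sup>2 \<le> 1 / (96 * pi ^ 3)"
    using \<beta> by (subst pos_divide_le_eq) auto
  then show "\<exists>R0>0. (R0 + R0\<^sup>2) / \<beta>\<^sup>2 \<le> 1 / (96 * pi ^ 3)"
    using R(1) by blast
next
  fix \<beta> R :: real
  assume \<beta>: "0 < \<beta>" and R: "0 < R" and "(R + R\<^sup>2) / \<beta>\<^sup>2 \<le> 1 / (96 * pi ^ 3)"
  then have small: "96 * pi ^ 3 * ((R + R\<^sup>2) / \<beta>\<^sup>2) \<le> 1"
    by (simp add: pos_le_divide_eq mult.commute)
  show "\<exists>\<delta>>0. \<forall>F0 :: vec3 \<Rightarrow> vec3 \<Rightarrow> real.
        (\<lambda>_. F0) \<in> gauss_space \<beta> \<and> gauss_norm \<beta> (\<lambda>_. F0) \<le> \<delta> \<and> (\<forall>x v. 0 \<le> F0 x v) \<longrightarrow>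
        (\<exists>F. nonneg_mild_solution_in_ball 1 \<beta> R F0 F \<and>
             (\<forall>G. nonneg_mild_solution_in_ball 1 \<beta> R F0 G \<longrightarrow>
                  (\<forall>t\<ge>0. \<forall>x v. G t x v = F t x v)))"
  \<comment> \<open>Half of the ball is reserved for the data, as the invariance of the ball under
    the Picard map demands.\<close>
  proof (rule exI[of _ "R / 2"], intro conjI allI impI)
    show "0 < R / 2" using R by simp
    fix F0 :: "vec3 \<Rightarrow> vec3 \<Rightarrow> real"
    assume "(\<lambda>_. F0) \<in> gauss_space \<beta> \<and> gauss_norm \<beta> (\<lambda>_. F0) \<le> R / 2 \<and> (\<forall>x v. 0 \<le> F0 x v)"
    then have ball: "(\<lambda>_. F0) \<in> gauss_ball \<beta> (R / 2)" and F0: "0 \<le> F0 x v" for x v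
      by (auto simp: gauss_ball_def)
    from gauss_bounded_clamp[OF ball] have gb: "gauss_bounded \<beta> (R / 2) (\<lambda>_. F0)" .
    have "continuous_on UNIV (\<lambda>p. F0 (fst p) (snd p))"
      using gb by (intro continuous_on_density[of "\<lambda>_. F0" _ "\<lambda>_. 0"] continuous_intros)
        (auto simp: gauss_bounded_def)
    then have F0_cont: "continuous_on UNIV (\<lambda>(x, v). F0 x v)"
      by (simp add: case_prod_beta)
    have "\<exists>!h. gauss_bounded \<beta> R h \<and> picard F0 h = h"
      by (intro picard_fixed_point[OF \<beta> _ F0_cont gauss_boundedD(1)[OF gb] small]) (use R in simp)
    then obtain h where "gauss_bounded \<beta> R h \<and> picard F0 h = h"
      and unique: "\<forall>g. gauss_bounded \<beta> R g \<and> picard F0 g = g \<longrightarrow> g = h"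
      by (rule ex1E)
    then have h: "gauss_bounded \<beta> R h" "picard F0 h = h"
      by blast+
    \<comment> \<open>The Picard map sees time only through \<open>max t 0\<close>, so its fixed
      point is constant on negative times.\<close>
    have clamp: "(\<lambda>t. h (max t 0)) = h"
    proof
      fix t
      have "picard F0 h (max t 0) = picard F0 h t"
        by (simp add: picard_def fun_eq_iff)
      then show "h (max t 0) = h t"
        by (simp only: h(2))
    qed
    define F where "F t x v = h t (x - t *\<^sub>R v) v" for t x v
    have sharp: "sharp F = h"
      by (simp add: sharp_def F_def fun_eq_iff)
    have F: "0 \<le> F t x v" if "0 \<le> t" for t x v
      unfolding F_def by (rule picard_fixed_point_nonneg[OF \<beta> h F0 that])
    show "\<exists>F. nonneg_mild_solution_in_ball 1 \<beta> R F0 F \<and>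
             (\<forall>G. nonneg_mild_solution_in_ball 1 \<beta> R F0 G \<longrightarrow>
                  (\<forall>t\<ge>0. \<forall>x v. G t x v = F t x v))"
    proof (intro exI[of _ F] conjI allI impI)
      have "h \<in> gauss_ball \<beta> R"
        by (rule gauss_bounded_imp_gauss_ball[OF h(1) R])
      moreover have "\<forall>t\<ge>0. \<forall>x v. sharp F t x v = F0 x v + (LINT \<tau>:{0..t}|lborel. sharp (Q 1 F) \<tau> x v)"
      proof -
        have "picard F0 (\<lambda>t. sharp F (max t 0)) = (\<lambda>t. sharp F (max t 0))"
          unfolding sharp clamp by (rule h(2))
        then show ?thesis
          using mild_solution_iff_picard[of F F0] F by blast
      qed
      ultimately show "nonneg_mild_solution_in_ball 1 \<beta> R F0 F"
        using F sharp unfolding nonneg_mild_solution_in_ball_def mild_solution_def gauss_ball_def by auto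
    next
      fix G :: density and t :: real and x v
      assume "nonneg_mild_solution_in_ball 1 \<beta> R F0 G" and t: "0 \<le> t"
      then have G: "sharp G \<in> gauss_ball \<beta> R" "\<And>t x v. 0 \<le> t \<Longrightarrow> 0 \<le> G t x v"
        and mild: "\<forall>t\<ge>0. \<forall>x v. sharp G t x v = F0 x v + (LINT \<tau>:{0..t}|lborel. sharp (Q 1 G) \<tau> x v)"
        by (auto simp: nonneg_mild_solution_in_ball_def mild_solution_def)
      have "picard F0 (\<lambda>t. sharp G (max t 0)) = (\<lambda>t. sharp G (max t 0))"
        using mild_solution_iff_picard[of G F0] G(2) mild by blast
      then have "(\<lambda>t. sharp G (max t 0)) = h"
        using unique gauss_bounded_clamp[OF G(1)] by blast
      \<comment> \<open>Evaluation at the foot x - t v of the characteristic undoes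
        \<open>sharp\<close>.\<close>
      then have "sharp G (max t 0) (x - t *\<^sub>R v) v = h t (x - t *\<^sub>R v) v"
        by (rule fun_cong[OF fun_cong[OF fun_cong]])
      then show "G t x v = F t x v"
        using t by (simp add: sharp_def F_def)
    qed
  qed
qed

end
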